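(* Let $A$ be a finite-dimensional $n$-Lie algebra over a field $\mathbf{F}$. Then the following statements hold: (1) $A$ contains a unique ideal, $E(A)$, the elementary commutator of $A$, such that $E(A)$ is contained in every ideal $B$ of $A$ for which $A/B$ is elementary. (2) $\Phi(A)\subseteq E(A)\subseteq S(A)$, where $S(A)$ is the intersection of the maximal subalgebras of $A$ which are also ideals of $A$. (3) $E(A)$ contains $\Phi(B)$ for all subalgebras $B$ of $A$. (4) $A$ is an $E$-algebra if and only if $E(A)=\Phi(A)$. (5) If $A=A_1\oplus A_2\oplus\cdots\oplus A_m$, where $A_i$, $i=1,\dots,m$, are ideals of $A$, then $E(A_1\oplus A_2\oplus\cdots\oplus A_m)=E(A_1)\oplus E(A_2)\oplus\cdots\oplus E(A_m)$. (6) If $A$ is not elementary, but every proper homomorphic image of $A$ is elementary, then $A$ possesses a unique minimal ideal. (7) If $K$ is an ideal of $A$, then $E(A/K)=(E(A)+K)/K$.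
   Context: An $n$-Lie algebra over a field $\mathbf{F}$ is a vector space $A$ over $\mathbf{F}$ with an $n$-ary multilinear operation $[\,,\dots,\,]$ satisfying $[x_1,\dots,x_n]=\operatorname{sgn}(\sigma)[x_{\sigma(1)},\dots,x_{\sigma(n)}]$ for all $\sigma\in S_n$ and $[[x_1,\dots,x_n],y_2,\dots,y_n]=\sum_{i=1}^n[x_1,\dots,[x_i,y_2,\dots,y_n],\dots,x_n]$. A subalgebra is a subspace $B$ with $[B,\dots,B]\subseteq B$; an ideal is a subspace $I$ with $[I,A,\dots,A]\subseteq I$. A proper subalgebra $M$ is maximal if the only subalgebra properly containing $M$ is $A$ itself. The Frattini subalgebra $F(A)$ is the intersection of all maximal subalgebras of $A$ (with $F(0)=0$), and $\Phi(A)$ is the largest ideal of $A$ contained in $F(A)$. An $n$-Lie algebra $L$ is elementary if $\Phi(C)=0$ for every subalgebra $C$ of $L$ (including $L$ itself). $A$ is an $E$-algebra if $\Phi(B)\subseteq\Phi(A)$ for all subalgebras $B$ of $A$. The ideal $E(A)$ is constructed as the intersection of all ideals $B$ of $A$ such that $A/B$ is elementary. A proper homomorphic image of $A$ is a quotient $A/B$ by a nonzero ideal $B$; a minimal ideal is a nonzero ideal containing no nonzero ideal other than itself. If $A$ has no maximal subalgebra that is an ideal, the (empty) intersection $S(A)$ is $A$. *)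

theory Defs
  imports
    "HOL-Algebra.QuotRing"
    "HOL-Combinatorics.Permutations"
    "Jordan_Normal_Form.Missing_VectorSpace"
begin

text \<open>The bracket takes the list \<open>[x\<^sub>1, \<dots>, x\<^sub>n]\<close> of its arguments. The fields
  \<^const>\<open>mult\<close> and \<^const>\<open>one\<close> inherited from HOL-Algebra modules are unconstrained and unused.\<close>

record ('a, 'b) n_lie = "('a, 'b) module" +
  bracket :: "'b list \<Rightarrow> 'b"

text \<open>Arguments are indexed by \<open>0, \<dots>, n - 1\<close>. The bracket is required to be skew-symmetric,
  not alternating, so in characteristic 2 it need not vanish on repeated arguments. The arity
  \<open>n = 1\<close>, usually excluded, is allowed; for \<open>n = 0\<close> the derivation identity has no meaning.\<close>

locale n_lie_algebra = vectorspace F A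
  for F :: "('a, 'm) ring_scheme" and A :: "('a, 'b, 'c) n_lie_scheme" and n :: nat +
  assumes arity_pos: "n > 0"
    and bracket_closed:
      "\<lbrakk>length xs = n; set xs \<subseteq> carrier A\<rbrakk> \<Longrightarrow> bracket A xs \<in> carrier A"
    and bracket_add:
      "\<lbrakk>length xs = n; set xs \<subseteq> carrier A; i < n; x \<in> carrier A; y \<in> carrier A\<rbrakk> \<Longrightarrow>
        bracket A (xs[i := x \<oplus>\<^bsub>A\<^esub> y]) = bracket A (xs[i := x]) \<oplus>\<^bsub>A\<^esub> bracket A (xs[i := y])"
    and bracket_smult:
      "\<lbrakk>length xs = n; set xs \<subseteq> carrier A; i < n; c \<in> carrier F; x \<in> carrier A\<rbrakk> \<Longrightarrow>
        bracket A (xs[i := c \<odot>\<^bsub>A\<^esub> x]) = c \<odot>\<^bsub>A\<^esub> bracket A (xs[i := x])"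
    and bracket_skew:
      "\<lbrakk>length xs = n; set xs \<subseteq> carrier A; \<sigma> permutes {..<n}\<rbrakk> \<Longrightarrow>
        bracket A xs = [sign \<sigma>] \<cdot>\<^bsub>A\<^esub> bracket A (permute_list \<sigma> xs)"
    and bracket_derivation:
      "\<lbrakk>length xs = n; set xs \<subseteq> carrier A; length ys = n - 1; set ys \<subseteq> carrier A\<rbrakk> \<Longrightarrow>
        bracket A (bracket A xs # ys) =
          (\<Oplus>\<^bsub>A\<^esub>i\<in>{..<n}. bracket A (xs[i := bracket A (xs ! i # ys)]))"

text \<open>A subalgebra \<open>C\<close> of \<open>A\<close>, regarded as an algebra, is \<open>A\<lparr>carrier := C\<rparr>\<close>.\<close>

definition nlie_subalgebra ::
    "('a, 'm) ring_scheme \<Rightarrow> nat \<Rightarrow> ('a, 'b, 'c) n_lie_scheme \<Rightarrow> 'b set \<Rightarrow> bool" where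
  "nlie_subalgebra F n A B \<longleftrightarrow>
    subspace F B A \<and> (\<forall>xs. length xs = n \<and> set xs \<subseteq> B \<longrightarrow> bracket A xs \<in> B)"

definition nlie_ideal ::
    "('a, 'm) ring_scheme \<Rightarrow> nat \<Rightarrow> ('a, 'b, 'c) n_lie_scheme \<Rightarrow> 'b set \<Rightarrow> bool" where
  "nlie_ideal F n A I \<longleftrightarrow>
    subspace F I A \<and>
    (\<forall>x ys. x \<in> I \<and> length ys = n - 1 \<and> set ys \<subseteq> carrier A \<longrightarrow> bracket A (x # ys) \<in> I)"

text \<open>The quotient algebra on the cosets of \<open>B\<close>; as in \<^const>\<open>FactRing\<close>, operations are unions over
  representatives, which are single cosets when \<open>B\<close> is an ideal.\<close>

definition nlie_quot :: "('a, 'b, 'c) n_lie_scheme \<Rightarrow> 'b set \<Rightarrow> ('a, 'b set) n_lie" where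
  "nlie_quot A B =
    \<lparr>carrier = a_rcosets\<^bsub>A\<^esub> B, mult = undefined, one = undefined, zero = B, add = set_add A,
     smult = (\<lambda>c X. \<Union>x\<in>X. B +>\<^bsub>A\<^esub> (c \<odot>\<^bsub>A\<^esub> x)),
     bracket = (\<lambda>Xs. \<Union>xs\<in>{xs. list_all2 (\<in>) xs Xs}. B +>\<^bsub>A\<^esub> bracket A xs)\<rparr>"

definition maximal_subalgebra ::
    "('a, 'm) ring_scheme \<Rightarrow> nat \<Rightarrow> ('a, 'b, 'c) n_lie_scheme \<Rightarrow> 'b set \<Rightarrow> bool" where
  "maximal_subalgebra F n A M \<longleftrightarrow>
    nlie_subalgebra F n A M \<and> M \<noteq> carrier A \<and>
    (\<forall>B. nlie_subalgebra F n A B \<and> M \<subset> B \<longrightarrow> B = carrier A)"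

definition minimal_ideal ::
    "('a, 'm) ring_scheme \<Rightarrow> nat \<Rightarrow> ('a, 'b, 'c) n_lie_scheme \<Rightarrow> 'b set \<Rightarrow> bool" where
  "minimal_ideal F n A I \<longleftrightarrow>
    nlie_ideal F n A I \<and> I \<noteq> {\<zero>\<^bsub>A\<^esub>} \<and>
    (\<forall>J. nlie_ideal F n A J \<and> J \<noteq> {\<zero>\<^bsub>A\<^esub>} \<and> J \<subseteq> I \<longrightarrow> J = I)"

text \<open>The intersection is taken inside \<open>A\<close>, so it is \<open>A\<close> if there is no maximal subalgebra; in
  particular the Frattini subalgebra of the zero algebra is zero.\<close>

definition frattini_subalgebra ::
    "('a, 'm) ring_scheme \<Rightarrow> nat \<Rightarrow> ('a, 'b, 'c) n_lie_scheme \<Rightarrow> 'b set" where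
  "frattini_subalgebra F n A = carrier A \<inter> \<Inter>{M. maximal_subalgebra F n A M}"

text \<open>\<^const>\<open>Greatest\<close> is with respect to inclusion of sets.\<close>

definition frattini_ideal ::
    "('a, 'm) ring_scheme \<Rightarrow> nat \<Rightarrow> ('a, 'b, 'c) n_lie_scheme \<Rightarrow> 'b set" where
  "frattini_ideal F n A =
    (GREATEST I. nlie_ideal F n A I \<and> I \<subseteq> frattini_subalgebra F n A)"

definition nlie_elementary ::
    "('a, 'm) ring_scheme \<Rightarrow> nat \<Rightarrow> ('a, 'b, 'c) n_lie_scheme \<Rightarrow> bool" where
  "nlie_elementary F n A \<longleftrightarrow>
    (\<forall>C. nlie_subalgebra F n A C \<longrightarrow> frattini_ideal F n (A\<lparr>carrier := C\<rparr>) = {\<zero>\<^bsub>A\<^esub>})"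

definition E_algebra ::
    "('a, 'm) ring_scheme \<Rightarrow> nat \<Rightarrow> ('a, 'b, 'c) n_lie_scheme \<Rightarrow> bool" where
  "E_algebra F n A \<longleftrightarrow>
    (\<forall>B. nlie_subalgebra F n A B \<longrightarrow>
      frattini_ideal F n (A\<lparr>carrier := B\<rparr>) \<subseteq> frattini_ideal F n A)"

text \<open>The family contains \<open>B = carrier A\<close>, whose quotient is zero, so it is never empty.\<close>

definition elementary_commutator ::
    "('a, 'm) ring_scheme \<Rightarrow> nat \<Rightarrow> ('a, 'b, 'c) n_lie_scheme \<Rightarrow> 'b set" where
  "elementary_commutator F n A =
    \<Inter>{B. nlie_ideal F n A B \<and> nlie_elementary F n (nlie_quot A B)}"

text \<open>The maximal subalgebras that are ideals; the value is \<open>A\<close> if there are none.\<close>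

definition maximal_ideal_intersection ::
    "('a, 'm) ring_scheme \<Rightarrow> nat \<Rightarrow> ('a, 'b, 'c) n_lie_scheme \<Rightarrow> 'b set" where
  "maximal_ideal_intersection F n A =
    carrier A \<inter> \<Inter>{M. maximal_subalgebra F n A M \<and> nlie_ideal F n A M}"

text \<open>\<open>S\<close> is the internal direct sum of the \<open>B i\<close>, \<open>i \<in> I\<close>: every element of \<open>S\<close> is a sum of
  elements of the \<open>B i\<close> in exactly one way, and all such sums lie in \<open>S\<close>.\<close>

definition internal_direct_sum ::
    "('b, 'c) ring_scheme \<Rightarrow> 'i set \<Rightarrow> ('i \<Rightarrow> 'b set) \<Rightarrow> 'b set \<Rightarrow> bool" where
  "internal_direct_sum A I B S \<longleftrightarrow>
    bij_betw (\<lambda>x. \<Oplus>\<^bsub>A\<^esub>i\<in>I. x i) (\<Pi>\<^sub>E i\<in>I. B i) S"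

end

theory Submission
  imports Defs
begin

text \<open>Write \<open>\<Phi>(C)\<close> for the Frattini ideal of a subalgebra \<open>C\<close>. All parts of the theorem follow
from one criterion, \<open>elementary_codomain_iff\<close>: the image of an epimorphism \<open>f\<close> from \<open>A\<close>
is elementary if and only if \<open>f\<close> kills \<open>\<Phi>(C)\<close> for every subalgebra \<open>C\<close> of
\<open>A\<close>.

One direction holds because preimages of maximal subalgebras are maximal, so that \<open>f\<close> maps
\<open>\<Phi>(C)\<close> into the Frattini ideal of \<open>f(C)\<close>. For the other one, let \<open>D\<close> be a subalgebra
of the image. By finite dimension some subalgebra \<open>C\<close> is minimal among those with
\<open>f(C) = D\<close>. No proper subalgebra of \<open>C\<close> maps onto \<open>D\<close>, and this forces the maximal
subalgebras of \<open>C\<close> to be the preimages of those of \<open>D\<close>. Hence \<open>\<Phi>(D)\<close> is the image of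
\<open>\<Phi>(C)\<close>, and \<open>f\<close> kills \<open>\<Phi>(C)\<close>.

Applied to quotient maps, the criterion says that \<open>A/B\<close> is elementary if and only if \<open>B\<close>
contains every \<open>\<Phi>(C)\<close>. So the elementary commutator \<open>E(A)\<close> is the least ideal containing
all \<open>\<Phi>(C)\<close>. This gives its universal property, that it contains \<open>\<Phi>(B)\<close> for all
subalgebras \<open>B\<close>, and that it equals \<open>\<Phi>(A)\<close> exactly for \<open>E\<close>-algebras. If every proper
quotient of \<open>A\<close> is elementary but \<open>A\<close> is not, then \<open>E(A)\<close> is nonzero and lies in every
nonzero ideal, so it is the unique minimal ideal. In any case \<open>E(A)\<close> lies in every maximal subalgebra
\<open>M\<close> that is an ideal, since \<open>A/M\<close> then has no proper nonzero subalgebra.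

A surjection also commutes with \<open>E\<close>: \<open>E(f(A)) = f(E(A))\<close>, see
\<open>elementary_commutator_image\<close>. For the quotient map by \<open>K\<close> this is the formula for
\<open>E(A/K)\<close>. For the projections onto the summands of a direct sum of ideals it shows that the
components of \<open>E(A)\<close> form the \<open>E(A\<^sub>i)\<close>; together with \<open>E(A\<^sub>i) \<subseteq> E(A)\<close> this yields the
direct decomposition.\<close>

section \<open>Multilinear skew-symmetric brackets\<close>

text \<open>Skew-symmetry is stated only for exchanges of the first argument with another one. They generate
all permutations, they are exactly what moves an arbitrary argument into the slot that the
definition of an ideal controls, and in this form skew-symmetry passes directly to homomorphic
images.\<close>


locale skew_algebra = vectorspace F A
  for F :: "('a, 'm) ring_scheme" and A :: "('a, 'b, 'c) n_lie_scheme" (structure) and n :: nat +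
  assumes arity_pos: "n > 0"
    and bracket_closed:
      "\<lbrakk>length xs = n; set xs \<subseteq> carrier A\<rbrakk> \<Longrightarrow> bracket A xs \<in> carrier A"
    and bracket_add:
      "\<lbrakk>length xs = n; set xs \<subseteq> carrier A; i < n; x \<in> carrier A; y \<in> carrier A\<rbrakk> \<Longrightarrow>
        bracket A (xs[i := x \<oplus> y]) = bracket A (xs[i := x]) \<oplus> bracket A (xs[i := y])"
    and bracket_smult:
      "\<lbrakk>length xs = n; set xs \<subseteq> carrier A; i < n; c \<in> carrier F; x \<in> carrier A\<rbrakk> \<Longrightarrow>
        bracket A (xs[i := c \<odot> x]) = c \<odot> bracket A (xs[i := x])"
    and bracket_swap:
      "\<lbrakk>length xs = n; set xs \<subseteq> carrier A; 0 < i; i < n\<rbrakk> \<Longrightarrow>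
        bracket A xs = \<ominus> bracket A (xs[0 := xs ! i, i := xs ! 0])"

lemma (in n_lie_algebra) skew_algebra: "skew_algebra F A n"
proof (intro skew_algebra.intro skew_algebra_axioms.intro)
  fix xs i
  assume xs: "length xs = n" "set xs \<subseteq> carrier A" and i: "0 < i" "i < n"
  let ?\<sigma> = "transpose 0 i"
  have "?\<sigma> permutes {..<n}"
    using i by (simp add: permutes_swap_id)
  then have *: "bracket A xs = [sign ?\<sigma>] \<cdot>\<^bsub>A\<^esub> bracket A (permute_list ?\<sigma> xs)"
    by (rule bracket_skew[OF xs])
  have perm: "permute_list ?\<sigma> xs = xs[0 := xs ! i, i := xs ! 0]"
  proof (rule nth_equalityI)
    fix j assume "j < length (permute_list ?\<sigma> xs)"
    then show "permute_list ?\<sigma> xs ! j = xs[0 := xs ! i, i := xs ! 0] ! j"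
      using xs i by (auto simp: permute_list_def transpose_def nth_list_update)
  qed simp
  have "set (xs[0 := xs ! i, i := xs ! 0]) \<subseteq> carrier A"
    using xs i by (simp add: set_swap)
  then have "bracket A (xs[0 := xs ! i, i := xs ! 0]) \<in> carrier A"
    using xs by (intro bracket_closed) auto
  then show "bracket A xs = \<ominus>\<^bsub>A\<^esub> bracket A (xs[0 := xs ! i, i := xs ! 0])"
    using * i unfolding perm by (simp add: sign_swap_id add_pow_int_lt)
qed (fact vectorspace_axioms arity_pos bracket_closed bracket_add bracket_smult)+

lemma (in vectorspace) subspace_iff:
  "subspace K B V \<longleftrightarrow> B \<subseteq> carrier V \<and> \<zero>\<^bsub>V\<^esub> \<in> B \<and> (\<forall>x\<in>B. \<forall>y\<in>B. x \<oplus>\<^bsub>V\<^esub> y \<in> B) \<and>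
     (\<forall>c\<in>carrier K. \<forall>x\<in>B. c \<odot>\<^bsub>V\<^esub> x \<in> B)"
proof -
  have "vectorspace K V" "module K V" by unfold_locales
  then show ?thesis
    unfolding subspace_def submodule_def by auto
qed

lemma (in vectorspace) subspace_minus:
  assumes "subspace K B V" "x \<in> B"
  shows "\<ominus>\<^bsub>V\<^esub> x \<in> B"
proof -
  have "x \<in> carrier V" using assms by (auto simp: subspace_iff)
  then have "\<ominus>\<^bsub>V\<^esub> x = (\<ominus>\<^bsub>K\<^esub> \<one>\<^bsub>K\<^esub>) \<odot>\<^bsub>V\<^esub> x" by (simp add: smult_l_minus)
  moreover have "\<ominus>\<^bsub>K\<^esub> \<one>\<^bsub>K\<^esub> \<in> carrier K" by simp
  ultimately show ?thesis using assms by (simp add: subspace_iff)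
qed

lemma (in vectorspace) subspace_add_set:
  assumes "subspace K B V" "subspace K C V"
  shows "subspace K (B <+>\<^bsub>V\<^esub> C) V"
proof -
  have B: "B \<subseteq> carrier V" and C: "C \<subseteq> carrier V" using assms by (auto simp: subspace_iff)
  show ?thesis
    unfolding subspace_iff set_add_def'
  proof (intro conjI ballI)
    show "(\<Union>h\<in>B. \<Union>k\<in>C. {h \<oplus>\<^bsub>V\<^esub> k}) \<subseteq> carrier V" using B C by auto
    show "\<zero>\<^bsub>V\<^esub> \<in> (\<Union>h\<in>B. \<Union>k\<in>C. {h \<oplus>\<^bsub>V\<^esub> k})"
      using assms by (auto simp: subspace_iff intro!: bexI[of _ "\<zero>\<^bsub>V\<^esub>"])
  next
    fix x y assume "x \<in> (\<Union>h\<in>B. \<Union>k\<in>C. {h \<oplus>\<^bsub>V\<^esub> k})" "y \<in> (\<Union>h\<in>B. \<Union>k\<in>C. {h \<oplus>\<^bsub>V\<^esub> k})"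
    then obtain b c b' c' where *: "b \<in> B" "c \<in> C" "x = b \<oplus>\<^bsub>V\<^esub> c" "b' \<in> B" "c' \<in> C" "y = b' \<oplus>\<^bsub>V\<^esub> c'"
      by blast
    then have "b \<in> carrier V" "c \<in> carrier V" "b' \<in> carrier V" "c' \<in> carrier V"
      using B C by auto
    then have "x \<oplus>\<^bsub>V\<^esub> y = (b \<oplus>\<^bsub>V\<^esub> b') \<oplus>\<^bsub>V\<^esub> (c \<oplus>\<^bsub>V\<^esub> c')"
      using * by (simp add: M.a_ac)
    moreover have "b \<oplus>\<^bsub>V\<^esub> b' \<in> B" "c \<oplus>\<^bsub>V\<^esub> c' \<in> C"
      using * assms by (auto simp: subspace_iff)
    ultimately show "x \<oplus>\<^bsub>V\<^esub> y \<in> (\<Union>h\<in>B. \<Union>k\<in>C. {h \<oplus>\<^bsub>V\<^esub> k})" by blast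
  next
    fix a x assume "a \<in> carrier K" "x \<in> (\<Union>h\<in>B. \<Union>k\<in>C. {h \<oplus>\<^bsub>V\<^esub> k})"
    then obtain b c where *: "a \<in> carrier K" "b \<in> B" "c \<in> C" "x = b \<oplus>\<^bsub>V\<^esub> c" by blast
    then have "b \<in> carrier V" "c \<in> carrier V" using B C by auto
    then have "a \<odot>\<^bsub>V\<^esub> x = a \<odot>\<^bsub>V\<^esub> b \<oplus>\<^bsub>V\<^esub> a \<odot>\<^bsub>V\<^esub> c" using * by (simp add: smult_r_distr)
    moreover have "a \<odot>\<^bsub>V\<^esub> b \<in> B" "a \<odot>\<^bsub>V\<^esub> c \<in> C"
      using * assms by (auto simp: subspace_iff)
    ultimately show "a \<odot>\<^bsub>V\<^esub> x \<in> (\<Union>h\<in>B. \<Union>k\<in>C. {h \<oplus>\<^bsub>V\<^esub> k})" by blast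
  qed
qed

context skew_algebra
begin

lemmas nlie_subalgebra_iff = nlie_subalgebra_def[of F n A, unfolded subspace_iff]

lemmas nlie_ideal_iff = nlie_ideal_def[of F n A, unfolded subspace_iff]

lemma subalgebra_subset: "nlie_subalgebra F n A B \<Longrightarrow> B \<subseteq> carrier A"
  by (simp add: nlie_subalgebra_iff)

lemma ideal_subset: "nlie_ideal F n A I \<Longrightarrow> I \<subseteq> carrier A"
  by (simp add: nlie_ideal_iff)

lemma ideal_is_subalgebra:
  assumes "nlie_ideal F n A I"
  shows "nlie_subalgebra F n A I"
  unfolding nlie_subalgebra_def
proof (intro conjI allI impI)
  show "subspace F I A" using assms by (simp add: nlie_ideal_def)
next
  fix xs assume xs: "length xs = n \<and> set xs \<subseteq> I"
  then obtain y ys where "xs = y # ys" using arity_pos by (cases xs) auto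
  then show "bracket A xs \<in> I"
    using xs assms ideal_subset[OF assms] by (auto simp: nlie_ideal_iff)
qed

lemma subalgebra_carrier: "nlie_subalgebra F n A (carrier A)"
  by (auto simp: nlie_subalgebra_iff bracket_closed)

lemma ideal_carrier: "nlie_ideal F n A (carrier A)"
  using arity_pos by (auto simp: nlie_ideal_iff intro!: bracket_closed)

lemma bracket_zero:
  assumes "length xs = n" "set xs \<subseteq> carrier A" "i < n"
  shows "bracket A (xs[i := \<zero>]) = \<zero>"
proof -
  have s: "set (xs[i := \<zero>]) \<subseteq> carrier A"
    using assms by (intro set_update_subsetI) auto
  have "bracket A (xs[i := \<zero>\<^bsub>F\<^esub> \<odot> \<zero>]) = \<zero>\<^bsub>F\<^esub> \<odot> bracket A (xs[i := \<zero>])"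
    using assms by (intro bracket_smult) auto
  then show ?thesis using s assms bracket_closed[of "xs[i := \<zero>]"] by simp
qed

lemma ideal_zero: "nlie_ideal F n A {\<zero>}"
proof -
  have "bracket A (\<zero> # ys) = \<zero>" if "length ys = n - 1" "set ys \<subseteq> carrier A" for ys
    using bracket_zero[of "\<zero> # ys" 0] that arity_pos by simp
  then show ?thesis by (simp add: nlie_ideal_iff)
qed

text \<open>Exchanging the slot \<open>i\<close> with the first one reduces this to the definition of an ideal.\<close>

lemma ideal_bracket_mem:
  assumes I: "nlie_ideal F n A I" and xs: "length xs = n" "set xs \<subseteq> carrier A"
    and i: "i < n" "xs ! i \<in> I"
  shows "bracket A xs \<in> I"
proof -
  have hd: "bracket A zs \<in> I" if "length zs = n" "set zs \<subseteq> carrier A" "zs ! 0 \<in> I" for zs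
    using that I arity_pos by (cases zs) (auto simp: nlie_ideal_iff)
  show ?thesis
  proof (cases "i = 0")
    case True
    then show ?thesis using hd xs i by auto
  next
    case False
    let ?zs = "xs[0 := xs ! i, i := xs ! 0]"
    have "set ?zs \<subseteq> carrier A"
      using xs i by (simp add: set_swap)
    then have "bracket A ?zs \<in> I"
      using xs i False by (intro hd) (auto simp: nth_list_update)
    then have "\<ominus> bracket A ?zs \<in> I"
      using I by (intro subspace_minus) (auto simp: nlie_ideal_def)
    then show ?thesis using bracket_swap[OF xs, of i] False i by simp
  qed
qed

text \<open>The bracket is compatible with congruence modulo an ideal, because the entries can be exchanged one
at a time and each exchange changes the value by a bracket with an entry in the ideal. This makes
quotients well defined, and it later shows that the projections of a direct sum of ideals preserve
brackets.\<close>

lemma bracket_cong_mod_ideal: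
  assumes I: "nlie_ideal F n A I"
    and xs: "length xs = n" "set xs \<subseteq> carrier A"
    and ys: "length ys = n" "set ys \<subseteq> carrier A"
    and diff: "\<And>i. i < n \<Longrightarrow> xs ! i \<ominus> ys ! i \<in> I"
  shows "bracket A xs \<ominus> bracket A ys \<in> I"
proof -
  have sub: "subspace F I A" using I by (simp add: nlie_ideal_def)
  \<comment> \<open>Replace the first \<open>k\<close> entries of \<open>ys\<close> by those of \<open>xs\<close>.\<close>
  have "bracket A (take k xs @ drop k ys) \<ominus> bracket A ys \<in> I" if "k \<le> n" for k
    using that
  proof (induction k)
    case 0
    then show ?case using sub bracket_closed[OF ys] by (simp add: subspace_iff M.minus_eq M.r_neg)
  next
    case (Suc k)
    define zs where "zs = take k xs @ drop k ys"
    define d where "d = xs ! k \<ominus> ys ! k"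
    have k: "k < n" using Suc by simp
    have zs: "length zs = n" "set zs \<subseteq> carrier A"
      using k xs ys set_take_subset[of k xs] set_drop_subset[of k ys] by (auto simp: zs_def)
    have car: "xs ! k \<in> carrier A" "ys ! k \<in> carrier A"
      using k xs ys nth_mem[of k xs] nth_mem[of k ys] by auto
    then have d: "d \<in> I" "d \<in> carrier A" using diff k by (auto simp: d_def)
    have "ys ! k \<oplus> d = xs ! k"
      using car by (simp add: d_def M.minus_eq M.a_lcomm[of "ys ! k"] M.r_neg)
    moreover have "take (Suc k) xs @ drop (Suc k) ys = zs[k := xs ! k]"
      using k xs ys by (intro nth_equalityI) (auto simp: zs_def nth_append nth_list_update)
    moreover have "zs[k := ys ! k] = zs"
      using k xs ys by (intro nth_equalityI) (auto simp: zs_def nth_append nth_list_update)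
    ultimately have "bracket A (take (Suc k) xs @ drop (Suc k) ys) = bracket A zs \<oplus> bracket A (zs[k := d])"
      using bracket_add[OF zs k car(2) d(2)] by simp
    moreover have zd: "set (zs[k := d]) \<subseteq> carrier A" using zs d by (intro set_update_subsetI)
    moreover have b: "bracket A (zs[k := d]) \<in> I"
      using ideal_bracket_mem[OF I _ zd k] zs k d by simp
    moreover have "bracket A zs \<ominus> bracket A ys \<in> I" using Suc by (simp add: zs_def)
    moreover have "(bracket A zs \<oplus> bracket A (zs[k := d])) \<ominus> bracket A ys
        = (bracket A zs \<ominus> bracket A ys) \<oplus> bracket A (zs[k := d])"
      using bracket_closed[OF zs] bracket_closed[OF ys] bracket_closed[OF _ zd] zs
      by (simp add: M.minus_eq M.a_ac)
    ultimately show ?case using sub by (simp add: subspace_iff)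
  qed
  from this[of n] show ?thesis using xs ys by simp
qed

lemma ideal_sum:
  assumes "nlie_ideal F n A I" "nlie_ideal F n A J"
  shows "nlie_ideal F n A (I <+>\<^bsub>A\<^esub> J)"
  unfolding nlie_ideal_def
proof (intro conjI allI impI)
  show "subspace F (I <+>\<^bsub>A\<^esub> J) A" using assms by (intro subspace_add_set) (auto simp: nlie_ideal_def)
next
  fix x ys assume *: "x \<in> I <+>\<^bsub>A\<^esub> J \<and> length ys = n - 1 \<and> set ys \<subseteq> carrier A"
  then obtain a b where ab: "a \<in> I" "b \<in> J" "x = a \<oplus> b" by (auto simp: set_add_def')
  then have "a \<in> carrier A" "b \<in> carrier A" using assms ideal_subset by auto
  then have "bracket A (x # ys) = bracket A (a # ys) \<oplus> bracket A (b # ys)"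
    using bracket_add[of "a # ys" 0 a b] ab * arity_pos by simp
  moreover have "bracket A (a # ys) \<in> I" "bracket A (b # ys) \<in> J"
    using assms ab * by (auto simp: nlie_ideal_def)
  ultimately show "bracket A (x # ys) \<in> I <+>\<^bsub>A\<^esub> J" by (auto simp: set_add_def')
qed

lemma ideal_Inter:
  assumes "\<And>I. I \<in> \<I> \<Longrightarrow> nlie_ideal F n A I" "\<I> \<noteq> {}"
  shows "nlie_ideal F n A (\<Inter>\<I>)"
  using assms unfolding nlie_ideal_iff by blast

lemma subalgebra_algebra:
  assumes "nlie_subalgebra F n A C"
  shows "skew_algebra F (A\<lparr>carrier := C\<rparr>) n"
proof -
  let ?C = "A\<lparr>carrier := C\<rparr>"
  have sub: "subspace F C A" using assms by (simp add: nlie_subalgebra_def)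
  interpret C: vectorspace F ?C using subspace_is_vs[OF sub] .
  have C: "C \<subseteq> carrier A" using subalgebra_subset[OF assms] .
  show ?thesis
  proof unfold_locales
    fix xs i assume xs: "length xs = n" "set xs \<subseteq> carrier ?C" and i: "0 < i" "i < n"
    let ?zs = "xs[0 := xs ! i, i := xs ! 0]"
    have "set ?zs \<subseteq> C"
      using xs i by (simp add: set_swap)
    then have b: "bracket A ?zs \<in> C" using assms xs by (simp add: nlie_subalgebra_def)
    then have neg: "\<ominus> bracket A ?zs \<in> C" by (intro subspace_minus[OF sub])
    have "\<ominus>\<^bsub>?C\<^esub> bracket A ?zs = \<ominus> bracket A ?zs"
      using b neg C M.l_neg[of "bracket A ?zs"]
      by (intro C.M.minus_equality[symmetric] C.M.minus_equality) auto
    then show "bracket ?C xs = \<ominus>\<^bsub>?C\<^esub> bracket ?C ?zs"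
      using bracket_swap[of xs i] xs i C by auto
  next
    fix xs assume "length xs = n" "set xs \<subseteq> carrier ?C"
    then show "bracket ?C xs \<in> carrier ?C" using assms by (simp add: nlie_subalgebra_def)
  next
    fix xs i x y assume "length xs = n" "set xs \<subseteq> carrier ?C" "i < n" "x \<in> carrier ?C" "y \<in> carrier ?C"
    then show "bracket ?C (xs[i := x \<oplus>\<^bsub>?C\<^esub> y]) = bracket ?C (xs[i := x]) \<oplus>\<^bsub>?C\<^esub> bracket ?C (xs[i := y])"
      using C bracket_add[of xs i x y] by auto
  next
    fix xs i c x assume "length xs = n" "set xs \<subseteq> carrier ?C" "i < n" "c \<in> carrier F" "x \<in> carrier ?C"
    then show "bracket ?C (xs[i := c \<odot>\<^bsub>?C\<^esub> x]) = c \<odot>\<^bsub>?C\<^esub> bracket ?C (xs[i := x])"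
      using C bracket_smult[of xs i c x] by auto
  qed (fact arity_pos)
qed

lemma subalgebra_of_subalgebra_iff:
  assumes "nlie_subalgebra F n A C"
  shows "nlie_subalgebra F n (A\<lparr>carrier := C\<rparr>) D \<longleftrightarrow> nlie_subalgebra F n A D \<and> D \<subseteq> C"
proof -
  interpret C: skew_algebra F "A\<lparr>carrier := C\<rparr>" n using subalgebra_algebra[OF assms] .
  show ?thesis
    using subalgebra_subset[OF assms] unfolding nlie_subalgebra_iff C.nlie_subalgebra_iff by auto
qed

lemma ideal_Int_subalgebra:
  assumes "nlie_subalgebra F n A C" "nlie_ideal F n A I"
  shows "nlie_ideal F n (A\<lparr>carrier := C\<rparr>) (I \<inter> C)"
proof -
  interpret C: skew_algebra F "A\<lparr>carrier := C\<rparr>" n using subalgebra_algebra[OF assms(1)] .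
  have "bracket A (x # ys) \<in> I \<inter> C" if "x \<in> I \<inter> C" "length ys = n - 1" "set ys \<subseteq> C" for x ys
    using assms that subalgebra_subset[OF assms(1)] arity_pos
    unfolding nlie_subalgebra_iff nlie_ideal_iff by auto
  then show ?thesis
    using assms unfolding nlie_subalgebra_iff nlie_ideal_iff C.nlie_ideal_iff by auto
qed

lemma subspace_frattini: "subspace F (frattini_subalgebra F n A) A"
  unfolding frattini_subalgebra_def subspace_iff maximal_subalgebra_def nlie_subalgebra_iff by auto

text \<open>The Frattini subalgebra is a subspace, so it contains the sum of any two ideals that it contains.
Hence the ideals inside it form a directed family, and their union is the largest of them.\<close>

lemma
  shows frattini_ideal_ideal: "nlie_ideal F n A (frattini_ideal F n A)"
    and frattini_ideal_subset: "frattini_ideal F n A \<subseteq> frattini_subalgebra F n A"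
    and frattini_ideal_upper:
      "\<And>I. nlie_ideal F n A I \<Longrightarrow> I \<subseteq> frattini_subalgebra F n A \<Longrightarrow> I \<subseteq> frattini_ideal F n A"
proof -
  let ?P = "\<lambda>I. nlie_ideal F n A I \<and> I \<subseteq> frattini_subalgebra F n A"
  define \<Phi> where "\<Phi> = \<Union>{I. ?P I}"
  have add: "x \<oplus> y \<in> \<Phi>" if "x \<in> \<Phi>" "y \<in> \<Phi>" for x y
  proof -
    from that obtain I J where IJ: "?P I" "?P J" "x \<in> I" "y \<in> J" by (auto simp: \<Phi>_def)
    have "I <+>\<^bsub>A\<^esub> J \<subseteq> frattini_subalgebra F n A"
      using IJ subspace_frattini by (auto simp: set_add_def' subspace_iff subset_iff)
    then have "?P (I <+>\<^bsub>A\<^esub> J)" using IJ ideal_sum by blast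
    moreover have "x \<oplus> y \<in> I <+>\<^bsub>A\<^esub> J" using IJ by (auto simp: set_add_def')
    ultimately show ?thesis by (auto simp: \<Phi>_def)
  qed
  have zero: "?P {\<zero>}" using ideal_zero subspace_frattini by (auto simp: subspace_iff)
  have "nlie_ideal F n A \<Phi>"
    unfolding nlie_ideal_iff
  proof (intro conjI ballI allI impI)
    show "\<Phi> \<subseteq> carrier A" using ideal_subset by (auto simp: \<Phi>_def)
    show "\<zero> \<in> \<Phi>" using zero by (auto simp: \<Phi>_def)
  next
    fix c x assume c: "c \<in> carrier F" and "x \<in> \<Phi>"
    then obtain I where "?P I" "x \<in> I" by (auto simp: \<Phi>_def)
    moreover from this c have "c \<odot> x \<in> I" by (simp add: nlie_ideal_iff)
    ultimately show "c \<odot> x \<in> \<Phi>" unfolding \<Phi>_def by blast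
  next
    fix x ys assume x: "x \<in> \<Phi> \<and> length ys = n - 1 \<and> set ys \<subseteq> carrier A"
    then obtain I where "?P I" "x \<in> I" by (auto simp: \<Phi>_def)
    moreover from this x have "bracket A (x # ys) \<in> I" by (simp add: nlie_ideal_iff)
    ultimately show "bracket A (x # ys) \<in> \<Phi>" unfolding \<Phi>_def by blast
  next
    fix x y assume "x \<in> \<Phi>" "y \<in> \<Phi>"
    then show "x \<oplus> y \<in> \<Phi>" by (rule add)
  qed
  then have P: "?P \<Phi>" by (auto simp: \<Phi>_def)
  moreover have up: "\<And>I. ?P I \<Longrightarrow> I \<subseteq> \<Phi>" by (auto simp: \<Phi>_def)
  ultimately have eq: "frattini_ideal F n A = \<Phi>"
    unfolding frattini_ideal_def by (intro Greatest_equality) auto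
  show "nlie_ideal F n A (frattini_ideal F n A)" "frattini_ideal F n A \<subseteq> frattini_subalgebra F n A"
    using P eq by auto
  show "\<And>I. nlie_ideal F n A I \<Longrightarrow> I \<subseteq> frattini_subalgebra F n A \<Longrightarrow> I \<subseteq> frattini_ideal F n A"
    using up eq by auto
qed

end

section \<open>Epimorphisms and the Frattini ideal\<close>

text \<open>The codomain is only a structure here; that it is again an algebra follows, since all axioms are
inherited along a surjection that preserves the operations. For a quotient only the coset
map has to be examined.\<close>


locale skew_epimorphism = skew_algebra F A n
  for F :: "('a, 'm) ring_scheme" and A :: "('a, 'b, 'c) n_lie_scheme" (structure) and n :: nat +
  fixes A' :: "('a, 'd, 'e) n_lie_scheme" and f :: "'b \<Rightarrow> 'd"
  assumes image_carrier: "f ` carrier A = carrier A'"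
    and hom_zero: "f \<zero> = \<zero>\<^bsub>A'\<^esub>"
    and hom_add: "\<lbrakk>x \<in> carrier A; y \<in> carrier A\<rbrakk> \<Longrightarrow> f (x \<oplus> y) = f x \<oplus>\<^bsub>A'\<^esub> f y"
    and hom_smult: "\<lbrakk>c \<in> carrier F; x \<in> carrier A\<rbrakk> \<Longrightarrow> f (c \<odot> x) = c \<odot>\<^bsub>A'\<^esub> f x"
    and hom_bracket: "\<lbrakk>length xs = n; set xs \<subseteq> carrier A\<rbrakk> \<Longrightarrow>
      f (bracket A xs) = bracket A' (map f xs)"
begin

lemma hom_closed: "x \<in> carrier A \<Longrightarrow> f x \<in> carrier A'"
  using image_carrier by blast

lemma hom_lift:
  assumes "y \<in> carrier A'"
  obtains x where "x \<in> carrier A" "y = f x"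
  using assms image_carrier by blast

lemma hom_lift_list:
  assumes "set ys \<subseteq> f ` C"
  obtains xs where "set xs \<subseteq> C" "ys = map f xs"
proof
  show "set (map (inv_into C f) ys) \<subseteq> C"
    using assms by (auto intro: inv_into_into)
  show "ys = map f (map (inv_into C f) ys)"
    using assms by (auto simp: f_inv_into_f subset_iff intro!: map_idI[symmetric])
qed

lemma codomain_vectorspace: "vectorspace F A'"
proof (intro vectorspace.intro moduleI abelian_groupI)
  show "cring F" "field F" by unfold_locales
next
  fix x assume "x \<in> carrier A'"
  then obtain a where a: "a \<in> carrier A" "x = f a" by (rule hom_lift)
  then have "f (\<ominus> a) \<oplus>\<^bsub>A'\<^esub> x = \<zero>\<^bsub>A'\<^esub>"
    by (simp add: hom_add[symmetric] M.l_neg hom_zero)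
  then show "\<exists>y\<in>carrier A'. y \<oplus>\<^bsub>A'\<^esub> x = \<zero>\<^bsub>A'\<^esub>" using a hom_closed by blast
  show "\<zero>\<^bsub>A'\<^esub> \<oplus>\<^bsub>A'\<^esub> x = x" using a by (simp add: hom_add[symmetric] flip: hom_zero)
  show "\<one>\<^bsub>F\<^esub> \<odot>\<^bsub>A'\<^esub> x = x" using a by (simp add: hom_smult[symmetric])
next
  show "\<zero>\<^bsub>A'\<^esub> \<in> carrier A'" using hom_closed[of \<zero>] by (simp add: hom_zero)
next
  fix x y assume "x \<in> carrier A'" "y \<in> carrier A'"
  then obtain a b where ab: "a \<in> carrier A" "x = f a" "b \<in> carrier A" "y = f b"
    by (metis hom_lift)
  then show "x \<oplus>\<^bsub>A'\<^esub> y \<in> carrier A'" "x \<oplus>\<^bsub>A'\<^esub> y = y \<oplus>\<^bsub>A'\<^esub> x"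
    by (simp_all add: hom_add[symmetric] hom_closed M.a_comm)
next
  fix x y z assume "x \<in> carrier A'" "y \<in> carrier A'" "z \<in> carrier A'"
  then obtain a b c where "a \<in> carrier A" "x = f a" "b \<in> carrier A" "y = f b" "c \<in> carrier A" "z = f c"
    by (metis hom_lift)
  then show "x \<oplus>\<^bsub>A'\<^esub> y \<oplus>\<^bsub>A'\<^esub> z = x \<oplus>\<^bsub>A'\<^esub> (y \<oplus>\<^bsub>A'\<^esub> z)"
    by (simp add: hom_add[symmetric] M.a_assoc)
next
  fix c x assume c: "c \<in> carrier F" and "x \<in> carrier A'"
  then obtain a where "a \<in> carrier A" "x = f a" by (metis hom_lift)
  then show "c \<odot>\<^bsub>A'\<^esub> x \<in> carrier A'" using c by (simp add: hom_smult[symmetric] hom_closed)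
next
  fix c d x assume cd: "c \<in> carrier F" "d \<in> carrier F" and "x \<in> carrier A'"
  then obtain a where a: "a \<in> carrier A" "x = f a" by (metis hom_lift)
  then show "(c \<oplus>\<^bsub>F\<^esub> d) \<odot>\<^bsub>A'\<^esub> x = c \<odot>\<^bsub>A'\<^esub> x \<oplus>\<^bsub>A'\<^esub> d \<odot>\<^bsub>A'\<^esub> x"
    "(c \<otimes>\<^bsub>F\<^esub> d) \<odot>\<^bsub>A'\<^esub> x = c \<odot>\<^bsub>A'\<^esub> (d \<odot>\<^bsub>A'\<^esub> x)"
    using cd by (simp_all add: hom_smult[symmetric] hom_add[symmetric] smult_l_distr smult_assoc1)
next
  fix c x y assume c: "c \<in> carrier F" and "x \<in> carrier A'" "y \<in> carrier A'"
  then obtain a b where ab: "a \<in> carrier A" "x = f a" "b \<in> carrier A" "y = f b" by (metis hom_lift)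
  then show "c \<odot>\<^bsub>A'\<^esub> (x \<oplus>\<^bsub>A'\<^esub> y) = c \<odot>\<^bsub>A'\<^esub> x \<oplus>\<^bsub>A'\<^esub> c \<odot>\<^bsub>A'\<^esub> y"
    using c by (simp add: hom_smult[symmetric] hom_add[symmetric] smult_r_distr)
qed

lemma hom_minus:
  assumes "x \<in> carrier A"
  shows "f (\<ominus> x) = \<ominus>\<^bsub>A'\<^esub> f x"
proof -
  interpret A': vectorspace F A' by (rule codomain_vectorspace)
  have "f (\<ominus> x) \<oplus>\<^bsub>A'\<^esub> f x = \<zero>\<^bsub>A'\<^esub>"
    using assms by (simp add: hom_add[symmetric] M.l_neg hom_zero)
  then show ?thesis using assms by (intro A'.M.minus_equality[symmetric] hom_closed) auto
qed

lemma codomain_algebra: "skew_algebra F A' n"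
proof (intro skew_algebra.intro skew_algebra_axioms.intro)
  show "vectorspace F A'" by (rule codomain_vectorspace)
  show "n > 0" by (rule arity_pos)
next
  fix ys assume "length ys = n" "set ys \<subseteq> carrier A'"
  then obtain xs where xs: "set xs \<subseteq> carrier A" "ys = map f xs"
    using hom_lift_list[of ys "carrier A"] image_carrier by metis
  then show "bracket A' ys \<in> carrier A'"
    using \<open>length ys = n\<close> by (simp add: hom_bracket[symmetric] hom_closed bracket_closed)
next
  fix ys i x y
  assume ys: "length ys = n" "set ys \<subseteq> carrier A'" and i: "i < n"
    and xy: "x \<in> carrier A'" "y \<in> carrier A'"
  obtain xs where xs: "set xs \<subseteq> carrier A" "ys = map f xs"
    using hom_lift_list[of ys "carrier A"] image_carrier ys by metis
  obtain a b where ab: "a \<in> carrier A" "x = f a" "b \<in> carrier A" "y = f b"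
    using xy by (metis hom_lift)
  have len: "length xs = n" using ys xs by simp
  have upd: "bracket A' (ys[i := f c]) = f (bracket A (xs[i := c]))"
    "bracket A (xs[i := c]) \<in> carrier A" if "c \<in> carrier A" for c
    using that xs len set_update_subsetI[OF xs(1) that, of i]
    by (simp_all add: hom_bracket map_update bracket_closed)
  show "bracket A' (ys[i := x \<oplus>\<^bsub>A'\<^esub> y]) = bracket A' (ys[i := x]) \<oplus>\<^bsub>A'\<^esub> bracket A' (ys[i := y])"
    using ab upd[of a] upd[of b] upd[of "a \<oplus> b"] bracket_add[OF len xs(1) i, of a b]
    by (simp add: hom_add)
next
  fix ys i c y
  assume ys: "length ys = n" "set ys \<subseteq> carrier A'" and i: "i < n"
    and c: "c \<in> carrier F" and y: "y \<in> carrier A'"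
  obtain xs where xs: "set xs \<subseteq> carrier A" "ys = map f xs"
    using hom_lift_list[of ys "carrier A"] image_carrier ys by metis
  obtain b where b: "b \<in> carrier A" "y = f b"
    using y by (metis hom_lift)
  have len: "length xs = n" using ys xs by simp
  have upd: "bracket A' (ys[i := f c]) = f (bracket A (xs[i := c]))"
    "bracket A (xs[i := c]) \<in> carrier A" if "c \<in> carrier A" for c
    using that xs len set_update_subsetI[OF xs(1) that, of i]
    by (simp_all add: hom_bracket map_update bracket_closed)
  show "bracket A' (ys[i := c \<odot>\<^bsub>A'\<^esub> y]) = c \<odot>\<^bsub>A'\<^esub> bracket A' (ys[i := y])"
    using b c upd[of b] upd[of "c \<odot> b"] bracket_smult[OF len xs(1) i, of c b]
    by (simp add: hom_smult)
next
  fix ys i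
  assume ys: "length ys = n" "set ys \<subseteq> carrier A'" and i: "0 < i" "i < n"
  obtain xs where xs: "set xs \<subseteq> carrier A" "ys = map f xs"
    using hom_lift_list[of ys "carrier A"] image_carrier ys by metis
  have len: "length xs = n" using ys xs by simp
  let ?xs = "xs[0 := xs ! i, i := xs ! 0]"
  have xs': "set ?xs \<subseteq> carrier A" using xs i len by (simp add: set_swap)
  have "bracket A' ys = f (\<ominus> bracket A ?xs)"
    using bracket_swap[OF len xs(1) i] hom_bracket[OF len xs(1)] xs by simp
  also have "\<dots> = \<ominus>\<^bsub>A'\<^esub> bracket A' (map f ?xs)"
    using xs' len by (simp add: hom_minus bracket_closed hom_bracket)
  also have "map f ?xs = ys[0 := ys ! i, i := ys ! 0]"
    using len i xs by (simp add: map_update)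
  finally show "bracket A' ys = \<ominus>\<^bsub>A'\<^esub> bracket A' (ys[0 := ys ! i, i := ys ! 0])" .
qed

end

sublocale skew_epimorphism \<subseteq> cod: skew_algebra F A' n
  by (rule codomain_algebra)

context skew_epimorphism
begin

lemma hom_diff_zero:
  assumes "x \<in> carrier A" "y \<in> carrier A" "f x = f y"
  shows "f (x \<ominus> y) = \<zero>\<^bsub>A'\<^esub>"
  using assms by (simp add: M.minus_eq hom_add hom_minus hom_closed cod.M.r_neg)

lemma subspace_image:
  assumes "subspace F B A"
  shows "subspace F (f ` B) A'"
proof -
  have B: "B \<subseteq> carrier A" using assms by (simp add: subspace_iff)
  have "f x \<oplus>\<^bsub>A'\<^esub> f y \<in> f ` B" if "x \<in> B" "y \<in> B" for x y
    using that assms B hom_add[of x y] by (metis image_eqI subspace_iff subsetD)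
  moreover have "c \<odot>\<^bsub>A'\<^esub> f x \<in> f ` B" if "c \<in> carrier F" "x \<in> B" for c x
    using that assms B hom_smult[of c x] by (metis image_eqI subspace_iff subsetD)
  moreover have "\<zero>\<^bsub>A'\<^esub> \<in> f ` B" using assms by (metis hom_zero image_eqI subspace_iff)
  ultimately show ?thesis unfolding cod.subspace_iff using B hom_closed by auto
qed

lemma subspace_vimage:
  assumes "subspace F B A'"
  shows "subspace F (carrier A \<inter> f -` B) A"
  using assms by (auto simp: subspace_iff cod.subspace_iff hom_add hom_smult hom_zero)

lemma image_subalgebra:
  assumes "nlie_subalgebra F n A C"
  shows "nlie_subalgebra F n A' (f ` C)"
  unfolding nlie_subalgebra_def
proof (intro conjI allI impI)
  show "subspace F (f ` C) A'" using assms by (intro subspace_image) (simp add: nlie_subalgebra_def)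
next
  fix ys assume ys: "length ys = n \<and> set ys \<subseteq> f ` C"
  then obtain xs where xs: "set xs \<subseteq> C" "ys = map f xs" using hom_lift_list by metis
  then have "bracket A xs \<in> C" using assms ys by (simp add: nlie_subalgebra_def)
  moreover have "bracket A' ys = f (bracket A xs)"
    using xs ys subalgebra_subset[OF assms] by (simp add: hom_bracket)
  ultimately show "bracket A' ys \<in> f ` C" by blast
qed

lemma vimage_subalgebra:
  assumes "nlie_subalgebra F n A' D"
  shows "nlie_subalgebra F n A (carrier A \<inter> f -` D)"
  unfolding nlie_subalgebra_def
proof (intro conjI allI impI)
  show "subspace F (carrier A \<inter> f -` D) A"
    using assms by (intro subspace_vimage) (simp add: nlie_subalgebra_def)
next
  fix xs assume xs: "length xs = n \<and> set xs \<subseteq> carrier A \<inter> f -` D"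
  then have "set (map f xs) \<subseteq> D" by auto
  then have "bracket A' (map f xs) \<in> D" using assms xs by (simp add: nlie_subalgebra_def)
  then show "bracket A xs \<in> carrier A \<inter> f -` D" using xs by (auto simp: hom_bracket bracket_closed)
qed

lemma image_ideal:
  assumes "nlie_ideal F n A I"
  shows "nlie_ideal F n A' (f ` I)"
  unfolding nlie_ideal_def
proof (intro conjI allI impI)
  show "subspace F (f ` I) A'" using assms by (intro subspace_image) (simp add: nlie_ideal_def)
next
  fix y ys assume ys: "y \<in> f ` I \<and> length ys = n - 1 \<and> set ys \<subseteq> carrier A'"
  then obtain x where x: "x \<in> I" "y = f x" by blast
  obtain xs where xs: "set xs \<subseteq> carrier A" "ys = map f xs"
    using hom_lift_list[of ys "carrier A"] image_carrier ys by metis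
  have "bracket A (x # xs) \<in> I" using assms x xs ys by (simp add: nlie_ideal_def)
  moreover have "bracket A' (y # ys) = f (bracket A (x # xs))"
    using xs ys x ideal_subset[OF assms] arity_pos by (subst hom_bracket) auto
  ultimately show "bracket A' (y # ys) \<in> f ` I" by blast
qed

lemma vimage_ideal:
  assumes "nlie_ideal F n A' J"
  shows "nlie_ideal F n A (carrier A \<inter> f -` J)"
  unfolding nlie_ideal_def
proof (intro conjI allI impI)
  show "subspace F (carrier A \<inter> f -` J) A"
    using assms by (intro subspace_vimage) (simp add: nlie_ideal_def)
next
  fix x ys assume x: "x \<in> carrier A \<inter> f -` J \<and> length ys = n - 1 \<and> set ys \<subseteq> carrier A"
  then have "set (map f ys) \<subseteq> carrier A'" using hom_closed by auto
  then have "bracket A' (f x # map f ys) \<in> J" using assms x by (simp add: nlie_ideal_def)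
  then show "bracket A (x # ys) \<in> carrier A \<inter> f -` J"
    using x arity_pos by (auto simp: hom_bracket bracket_closed)
qed

lemma image_vimage:
  assumes "D \<subseteq> carrier A'"
  shows "f ` (carrier A \<inter> f -` D) = D"
proof
  show "D \<subseteq> f ` (carrier A \<inter> f -` D)"
  proof
    fix y assume y: "y \<in> D"
    then obtain x where "x \<in> carrier A" "y = f x" using assms by (blast elim: hom_lift)
    then show "y \<in> f ` (carrier A \<inter> f -` D)" using y by simp
  qed
qed auto

lemma vimage_image_subalgebra:
  assumes B: "nlie_subalgebra F n A B" and ker: "carrier A \<inter> f -` {\<zero>\<^bsub>A'\<^esub>} \<subseteq> B"
  shows "carrier A \<inter> f -` (f ` B) = B"
proof
  show "carrier A \<inter> f -` (f ` B) \<subseteq> B"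
  proof
    fix x assume "x \<in> carrier A \<inter> f -` (f ` B)"
    then obtain b where b: "b \<in> B" "f x = f b" and x: "x \<in> carrier A" by auto
    then have bA: "b \<in> carrier A" using subalgebra_subset[OF B] by auto
    then have "x \<ominus> b \<in> B" using ker hom_diff_zero[OF x bA b(2)] x by auto
    then have "(x \<ominus> b) \<oplus> b \<in> B" using B b by (simp add: nlie_subalgebra_iff)
    then show "x \<in> B" using x bA by (simp add: M.minus_eq M.a_assoc M.l_neg)
  qed
qed (use subalgebra_subset[OF B] in auto)

lemma restrict_epimorphism:
  assumes "nlie_subalgebra F n A C"
  shows "skew_epimorphism F (A\<lparr>carrier := C\<rparr>) n (A'\<lparr>carrier := f ` C\<rparr>) f"
proof (intro skew_epimorphism.intro skew_epimorphism_axioms.intro)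
  show "skew_algebra F (A\<lparr>carrier := C\<rparr>) n" using subalgebra_algebra[OF assms] .
qed (use subalgebra_subset[OF assms] in \<open>auto intro!: hom_zero hom_add hom_smult hom_bracket\<close>)

text \<open>A subalgebra above the preimage contains the kernel, so it is determined by its image.\<close>

lemma vimage_maximal_subalgebra:
  assumes "maximal_subalgebra F n A' M"
  shows "maximal_subalgebra F n A (carrier A \<inter> f -` M)"
  unfolding maximal_subalgebra_def
proof (intro conjI allI impI)
  let ?M = "carrier A \<inter> f -` M"
  have M: "nlie_subalgebra F n A' M" "M \<noteq> carrier A'"
    and max: "\<And>D. nlie_subalgebra F n A' D \<Longrightarrow> M \<subset> D \<Longrightarrow> D = carrier A'"
    using assms by (auto simp: maximal_subalgebra_def)
  show "nlie_subalgebra F n A ?M" using M by (intro vimage_subalgebra)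
  show "?M \<noteq> carrier A"
  proof
    assume "?M = carrier A"
    then have "f ` carrier A \<subseteq> M" by blast
    then show False using M(2) cod.subalgebra_subset[OF M(1)] by (simp add: image_carrier)
  qed
  fix B assume B: "nlie_subalgebra F n A B \<and> ?M \<subset> B"
  have "f ` ?M \<subseteq> f ` B" using B by (intro image_mono) auto
  then have "M \<subseteq> f ` B" by (simp add: image_vimage cod.subalgebra_subset[OF M(1)])
  moreover have "\<not> f ` B \<subseteq> M"
  proof
    assume "f ` B \<subseteq> M"
    then have "B \<subseteq> ?M" using B subalgebra_subset[of B] by auto
    then show False using B by auto
  qed
  ultimately have "f ` B = carrier A'" using B by (intro max image_subalgebra) auto
  moreover have "carrier A \<inter> f -` {\<zero>\<^bsub>A'\<^esub>} \<subseteq> B" using B M by (auto simp: cod.nlie_subalgebra_iff)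
  ultimately show "B = carrier A" using vimage_image_subalgebra[of B] B hom_closed by auto
qed

lemma frattini_ideal_image: "f ` frattini_ideal F n A \<subseteq> frattini_ideal F n A'"
proof (rule cod.frattini_ideal_upper)
  show "nlie_ideal F n A' (f ` frattini_ideal F n A)"
    by (intro image_ideal frattini_ideal_ideal)
  show "f ` frattini_ideal F n A \<subseteq> frattini_subalgebra F n A'"
  proof
    fix y assume "y \<in> f ` frattini_ideal F n A"
    then obtain x where x: "x \<in> frattini_ideal F n A" "y = f x" by blast
    then have xF: "x \<in> frattini_subalgebra F n A" using frattini_ideal_subset by blast
    then have "f x \<in> M" if "maximal_subalgebra F n A' M" for M
      using vimage_maximal_subalgebra[OF that] by (auto simp: frattini_subalgebra_def)
    then show "y \<in> frattini_subalgebra F n A'"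
      using xF x hom_closed by (auto simp: frattini_subalgebra_def)
  qed
qed

text \<open>Here no proper subalgebra maps onto the codomain. Then the image of a maximal subalgebra is proper,
hence maximal, and the maximal subalgebra is the full preimage of its image. So the preimage of the
Frattini ideal of the codomain is an ideal that lies in every maximal subalgebra.\<close>

lemma frattini_ideal_vimage:
  assumes ess: "\<And>C. nlie_subalgebra F n A C \<Longrightarrow> f ` C = carrier A' \<Longrightarrow> C = carrier A"
  shows "carrier A \<inter> f -` frattini_ideal F n A' \<subseteq> frattini_ideal F n A"
proof (rule frattini_ideal_upper)
  let ?I = "carrier A \<inter> f -` frattini_ideal F n A'"
  show "nlie_ideal F n A ?I" by (intro vimage_ideal cod.frattini_ideal_ideal)
  show "?I \<subseteq> frattini_subalgebra F n A"
  proof -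
    have "x \<in> M" if x: "x \<in> ?I" and "maximal_subalgebra F n A M" for x M
    proof -
      have M: "nlie_subalgebra F n A M" "M \<noteq> carrier A"
        and max: "\<And>B. nlie_subalgebra F n A B \<Longrightarrow> M \<subset> B \<Longrightarrow> B = carrier A"
        using that by (auto simp: maximal_subalgebra_def)
      have proper: "f ` M \<noteq> carrier A'" using ess M by blast
      have MN: "M \<subseteq> carrier A \<inter> f -` D" if "f ` M \<subseteq> D" for D
        using that subalgebra_subset[OF M(1)] by auto
      have "D = carrier A'" if D: "nlie_subalgebra F n A' D" "f ` M \<subset> D" for D
      proof -
        have img: "f ` (carrier A \<inter> f -` D) = D"
          by (intro image_vimage cod.subalgebra_subset[OF D(1)])
        then have "carrier A \<inter> f -` D = carrier A"
          using D MN[of D] by (intro max vimage_subalgebra) auto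
        then show ?thesis using img image_carrier by simp
      qed
      then have "maximal_subalgebra F n A' (f ` M)"
        using M proper by (auto simp: maximal_subalgebra_def intro: image_subalgebra)
      then have "f x \<in> f ` M"
        using x cod.frattini_ideal_subset by (auto simp: frattini_subalgebra_def)
      then have "x \<in> carrier A \<inter> f -` (f ` M)" using x by auto
      moreover have "carrier A \<inter> f -` (f ` M) = M"
      proof (rule ccontr)
        assume "carrier A \<inter> f -` (f ` M) \<noteq> M"
        then have "carrier A \<inter> f -` (f ` M) = carrier A"
          using M MN[of "f ` M"] by (intro max vimage_subalgebra image_subalgebra) auto
        then have "f ` carrier A \<subseteq> f ` M" by blast
        then show False
          using proper cod.subalgebra_subset[OF image_subalgebra[OF M(1)]] by (simp add: image_carrier)
      qed
      ultimately show ?thesis by simp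
    qed
    then show ?thesis by (auto simp: frattini_subalgebra_def)
  qed
qed

end

lemma (in skew_algebra) id_epimorphism: "skew_epimorphism F A n A id"
  by (intro skew_epimorphism.intro skew_epimorphism_axioms.intro skew_algebra_axioms) auto

lemma comp_epimorphism:
  assumes "skew_epimorphism F A n A' f" "skew_epimorphism F A' n A'' g"
  shows "skew_epimorphism F A n A'' (g \<circ> f)"
proof -
  interpret f: skew_epimorphism F A n A' f by fact
  interpret g: skew_epimorphism F A' n A'' g by fact
  show ?thesis
  proof (intro skew_epimorphism.intro skew_epimorphism_axioms.intro)
    fix xs assume xs: "length xs = n" "set xs \<subseteq> carrier A"
    then have "set (map f xs) \<subseteq> carrier A'" using f.hom_closed by auto
    then show "(g \<circ> f) (bracket A xs) = bracket A'' (map (g \<circ> f) xs)"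
      using xs by (simp add: f.hom_bracket g.hom_bracket)
  next
    show "(g \<circ> f) ` carrier A = carrier A''"
      by (simp only: image_comp[symmetric] f.image_carrier g.image_carrier)
  qed (auto simp: f.skew_algebra_axioms f.hom_zero g.hom_zero f.hom_add g.hom_add f.hom_smult g.hom_smult f.hom_closed)
qed

context skew_algebra
begin

lemma ideal_abelian_subgroup:
  assumes "nlie_ideal F n A B"
  shows "abelian_subgroup B A"
proof (intro abelian_subgroupI3 additive_subgroupI M.abelian_group_axioms)
  have sub: "subspace F B A" using assms by (simp add: nlie_ideal_def)
  then show "subgroup B (add_monoid A)"
    using subspace_minus[OF sub] unfolding subspace_iff
    by (intro M.add.subgroupI) (auto simp: a_inv_def)
qed

lemma ideal_coset_eq_iff:
  assumes "nlie_ideal F n A B" "x \<in> carrier A" "y \<in> carrier A"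
  shows "B +> x = B +> y \<longleftrightarrow> x \<ominus> y \<in> B"
proof -
  interpret B: abelian_subgroup B A by (rule ideal_abelian_subgroup[OF assms(1)])
  have "B +> x = B +> y \<longleftrightarrow> x \<in> B +> y"
    using assms B.a_repr_independence'[of x y] B.a_repr_independenceD[of x y] by metis
  also have "\<dots> \<longleftrightarrow> x \<ominus> y \<in> B" using assms by (simp add: B.a_rcos_module M.minus_eq)
  finally show ?thesis .
qed

lemma ideal_coset_eq_self_iff:
  assumes "nlie_ideal F n A B" "x \<in> carrier A"
  shows "B +> x = B \<longleftrightarrow> x \<in> B"
proof -
  have neg: "\<ominus> \<zero> = \<zero>" by (intro M.minus_equality) auto
  have "x \<ominus> \<zero> = x" unfolding M.minus_eq neg using assms by simp
  moreover have "B +> \<zero> = B" using ideal_subset[OF assms(1)] by simp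
  ultimately show ?thesis using ideal_coset_eq_iff[OF assms, of \<zero>] by simp
qed

lemma quotient_epimorphism:
  assumes B: "nlie_ideal F n A B"
  shows "skew_epimorphism F A n (nlie_quot A B) (\<lambda>x. B +> x)"
proof -
  interpret B: abelian_subgroup B A by (rule ideal_abelian_subgroup[OF B])
  have mem: "y \<in> carrier A" "y \<ominus> x \<in> B" if "x \<in> carrier A" "y \<in> B +> x" for x y
    using B.a_elemrcos_carrier[OF that] B.a_rcos_module_imp[OF that] by (simp_all add: M.minus_eq)
  show ?thesis
  proof (intro skew_epimorphism.intro skew_epimorphism_axioms.intro)
    show "skew_algebra F A n" by unfold_locales
    show "(\<lambda>x. B +> x) ` carrier A = carrier (nlie_quot A B)"
      by (auto simp: nlie_quot_def A_RCOSETS_def')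
    show "B +> \<zero> = \<zero>\<^bsub>nlie_quot A B\<^esub>"
      using ideal_subset[OF B] by (simp add: nlie_quot_def)
  next
    fix x y assume "x \<in> carrier A" "y \<in> carrier A"
    then show "B +> (x \<oplus> y) = (B +> x) \<oplus>\<^bsub>nlie_quot A B\<^esub> (B +> y)"
      by (simp add: nlie_quot_def B.a_rcos_sum)
  next
    fix c x assume c: "c \<in> carrier F" and x: "x \<in> carrier A"
    have "B +> (c \<odot> y) = B +> (c \<odot> x)" if "y \<in> B +> x" for y
    proof -
      have y: "y \<in> carrier A" "y \<ominus> x \<in> B" using mem[OF x that] .
      then have "c \<odot> (y \<ominus> x) \<in> B" using B c by (simp add: nlie_ideal_iff)
      also have "c \<odot> (y \<ominus> x) = c \<odot> y \<ominus> c \<odot> x"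
        using x y c by (simp add: M.minus_eq smult_r_distr smult_r_minus)
      finally show ?thesis using x y c by (simp add: ideal_coset_eq_iff[OF B])
    qed
    moreover have "x \<in> B +> x" using x B.a_rcos_self by blast
    ultimately have "(\<Union>y\<in>B +> x. B +> (c \<odot> y)) = B +> (c \<odot> x)" by blast
    then show "B +> (c \<odot> x) = c \<odot>\<^bsub>nlie_quot A B\<^esub> (B +> x)"
      by (simp add: nlie_quot_def)
  next
    fix xs assume xs: "length xs = n" "set xs \<subseteq> carrier A"
    let ?S = "{ys. list_all2 (\<in>) ys (map (\<lambda>x. B +> x) xs)}"
    have "B +> bracket A ys = B +> bracket A xs" if "ys \<in> ?S" for ys
    proof -
      have ys: "length ys = n" "\<And>i. i < n \<Longrightarrow> ys ! i \<in> B +> (xs ! i)"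
        using that xs by (auto simp: list_all2_conv_all_nth)
      have i: "ys ! i \<in> carrier A" "ys ! i \<ominus> xs ! i \<in> B" if "i < n" for i
        using mem[OF subsetD[OF xs(2) nth_mem] ys(2)[OF that]] that xs by simp_all
      then have "set ys \<subseteq> carrier A" using ys(1) by (auto simp: in_set_conv_nth)
      then show ?thesis
        using bracket_cong_mod_ideal[OF B ys(1) _ xs i(2)] ys xs
        by (simp add: ideal_coset_eq_iff[OF B] bracket_closed)
    qed
    moreover have "xs \<in> ?S"
      using xs B.a_rcos_self by (auto simp: list_all2_conv_all_nth subset_iff)
    ultimately have "(\<Union>ys\<in>?S. B +> bracket A ys) = B +> bracket A xs" by blast
    then show "B +> bracket A xs = bracket (nlie_quot A B) (map (\<lambda>x. B +> x) xs)"
      by (simp add: nlie_quot_def)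
  qed
qed

end

section \<open>The elementary commutator\<close>

text \<open>The rank, that is the largest size of a linearly independent subset, increases strictly along
proper inclusions of subspaces.\<close>


lemma (in vectorspace) wf_subspaces:
  assumes fd: "fin_dim"
  shows "wf {(B, C). subspace K B V \<and> subspace K C V \<and> B \<subset> C}"
proof -
  define ind where "ind B = {S. S \<subseteq> B \<and> lin_indpt S}" for B
  define rank where "rank B = Max (card ` ind B)" for B
  have ind: "finite S \<and> card S \<le> dim" if "S \<in> ind B" "subspace K B V" for S B
    using that li_le_dim[OF fd, of S] by (auto simp: ind_def subspace_iff)
  have fin: "finite (card ` ind B)" if "subspace K B V" for B
  proof (rule finite_subset)
    show "card ` ind B \<subseteq> {..dim}" using ind[OF _ that] by (intro image_subsetI) simp
  qed simp
  have ne: "{} \<in> ind B" for B by (auto simp: ind_def lin_dep_def)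
  have mono: "rank B < rank C" if B: "subspace K B V" and C: "subspace K C V" and BC: "B \<subset> C" for B C
  proof -
    \<comment> \<open>A vector outside of \<open>B\<close> enlarges an independent set of maximal size in \<open>B\<close>.\<close>
    have "rank B \<in> card ` ind B" unfolding rank_def using fin[OF B] ne by (intro Max_in) auto
    then obtain S where S: "S \<in> ind B" "rank B = card S" by auto
    obtain v where v: "v \<in> C" "v \<notin> B" using BC by auto
    have car: "B \<subseteq> carrier V" "v \<in> carrier V" using B C v by (auto simp: subspace_iff)
    have SB: "S \<subseteq> B" "lin_indpt S" using S by (auto simp: ind_def)
    have "span S \<subseteq> B" using B SB by (intro span_is_subset) auto
    then have "v \<notin> span S" "v \<notin> S" using v SB by auto
    then have "lin_indpt (S \<union> {v})"
      using lin_dep_iff_in_span[of S v] SB car by auto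
    then have Sv: "S \<union> {v} \<in> ind C" using SB v BC by (auto simp: ind_def)
    then have "card (S \<union> {v}) \<le> rank C" unfolding rank_def using fin[OF C] by (intro Max_ge) auto
    moreover have "card (S \<union> {v}) = Suc (card S)" using ind[OF S(1) B] \<open>v \<notin> S\<close> by simp
    ultimately show ?thesis using S by simp
  qed
  show ?thesis
  proof (rule wf_subset[OF wf_measure[of rank]], rule subrelI)
    fix B C assume "(B, C) \<in> {(B, C). subspace K B V \<and> subspace K C V \<and> B \<subset> C}"
    then have "rank B < rank C" by (intro mono) simp_all
    then show "(B, C) \<in> measure rank" by simp
  qed
qed

text \<open>The descending chain condition is how finite dimension enters: it provides minimal subalgebras
mapping onto a given one. Unlike a dimension count it is inherited by subalgebras at once.\<close>
definition subalgebra_dcc ::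
    "('a, 'm) ring_scheme \<Rightarrow> nat \<Rightarrow> ('a, 'b, 'c) n_lie_scheme \<Rightarrow> bool" where
  "subalgebra_dcc F n A \<longleftrightarrow>
    wf {(C, D). nlie_subalgebra F n A C \<and> nlie_subalgebra F n A D \<and> C \<subset> D}"

lemma fin_dim_subalgebra_dcc:
  fixes A :: "('a, 'b, 'c) n_lie_scheme"
  assumes "vectorspace F A" "vectorspace.fin_dim F A"
  shows "subalgebra_dcc F n A"
  using vectorspace.wf_subspaces[OF assms] unfolding subalgebra_dcc_def
  by (rule wf_subset) (auto simp: nlie_subalgebra_def)

context skew_algebra
begin

lemma frattini_ideal_trivial_iff:
  "frattini_ideal F n A = {\<zero>} \<longleftrightarrow> frattini_ideal F n A \<subseteq> {\<zero>}"
  using frattini_ideal_ideal by (auto simp: nlie_ideal_iff)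

lemma dcc_subalgebra:
  assumes "subalgebra_dcc F n A" "nlie_subalgebra F n A C"
  shows "subalgebra_dcc F n (A\<lparr>carrier := C\<rparr>)"
  using assms(1) unfolding subalgebra_dcc_def
  by (rule wf_subset) (auto simp: subalgebra_of_subalgebra_iff[OF assms(2)])

lemma frattini_ideal_subalgebra_subset:
  assumes "nlie_subalgebra F n A C"
  shows "frattini_ideal F n (A\<lparr>carrier := C\<rparr>) \<subseteq> C"
proof -
  interpret C: skew_algebra F "A\<lparr>carrier := C\<rparr>" n by (rule subalgebra_algebra[OF assms])
  show ?thesis using C.ideal_subset[OF C.frattini_ideal_ideal] by simp
qed

end

text \<open>The key fact: elementarity of an epimorphic image can be read off from the Frattini ideals of the
subalgebras of the domain. If the image is elementary, these are killed because Frattini ideals map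
into Frattini ideals. Conversely, a subalgebra \<open>D\<close> of the image is the image of a minimal
subalgebra \<open>C\<close>, and minimality makes every element of \<open>\<Phi>(D)\<close> the image of an
element of \<open>\<Phi>(C)\<close>.\<close>

lemma (in skew_epimorphism) elementary_codomain_iff:
  assumes dcc: "subalgebra_dcc F n A"
  shows "nlie_elementary F n A' \<longleftrightarrow>
    (\<forall>C. nlie_subalgebra F n A C \<longrightarrow> f ` frattini_ideal F n (A\<lparr>carrier := C\<rparr>) \<subseteq> {\<zero>\<^bsub>A'\<^esub>})"
proof (intro iffI allI impI)
  fix C assume el: "nlie_elementary F n A'" and C: "nlie_subalgebra F n A C"
  interpret r: skew_epimorphism F "A\<lparr>carrier := C\<rparr>" n "A'\<lparr>carrier := f ` C\<rparr>" f
    by (rule restrict_epimorphism[OF C])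
  show "f ` frattini_ideal F n (A\<lparr>carrier := C\<rparr>) \<subseteq> {\<zero>\<^bsub>A'\<^esub>}"
    using r.frattini_ideal_image el image_subalgebra[OF C] by (auto simp: nlie_elementary_def)
next
  assume triv: "\<forall>C. nlie_subalgebra F n A C \<longrightarrow>
    f ` frattini_ideal F n (A\<lparr>carrier := C\<rparr>) \<subseteq> {\<zero>\<^bsub>A'\<^esub>}"
  show "nlie_elementary F n A'"
    unfolding nlie_elementary_def
  proof (intro allI impI)
    fix D assume D: "nlie_subalgebra F n A' D"
    let ?Q = "{C. nlie_subalgebra F n A C \<and> f ` C = D}"
    have "carrier A \<inter> f -` D \<in> ?Q"
      using vimage_subalgebra[OF D] image_vimage[OF cod.subalgebra_subset[OF D]] by simp
    from wf_eq_minimal[THEN iffD1, rule_format, OF dcc[unfolded subalgebra_dcc_def] this]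
    obtain C where C: "C \<in> ?Q" and minimal: "\<forall>B. (B, C) \<in> {(C, D).
        nlie_subalgebra F n A C \<and> nlie_subalgebra F n A D \<and> C \<subset> D} \<longrightarrow> B \<notin> ?Q"
      by (elim bexE)
    have CD: "nlie_subalgebra F n A C" "f ` C = D" using C by simp_all
    have min: "f ` B \<noteq> D" if "nlie_subalgebra F n A B" "B \<subset> C" for B
      using minimal that CD by simp
    interpret r: skew_epimorphism F "A\<lparr>carrier := C\<rparr>" n "A'\<lparr>carrier := D\<rparr>" f
      using restrict_epimorphism[OF CD(1)] unfolding CD(2) .
    have "carrier (A\<lparr>carrier := C\<rparr>) \<inter> f -` frattini_ideal F n (A'\<lparr>carrier := D\<rparr>)
        \<subseteq> frattini_ideal F n (A\<lparr>carrier := C\<rparr>)"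
    proof (rule r.frattini_ideal_vimage)
      fix B assume "nlie_subalgebra F n (A\<lparr>carrier := C\<rparr>) B" "f ` B = carrier (A'\<lparr>carrier := D\<rparr>)"
      then show "B = carrier (A\<lparr>carrier := C\<rparr>)"
        using min[of B] CD by (auto simp: subalgebra_of_subalgebra_iff[OF CD(1)])
    qed
    then have ess: "c \<in> frattini_ideal F n (A\<lparr>carrier := C\<rparr>)"
      if "c \<in> C" "f c \<in> frattini_ideal F n (A'\<lparr>carrier := D\<rparr>)" for c
      using that by auto
    have "frattini_ideal F n (A'\<lparr>carrier := D\<rparr>) \<subseteq> {\<zero>\<^bsub>A'\<^esub>}"
    proof
      fix y assume y: "y \<in> frattini_ideal F n (A'\<lparr>carrier := D\<rparr>)"
      then have "y \<in> f ` C" using cod.frattini_ideal_subalgebra_subset[OF D] CD(2) by auto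
      then obtain c where c: "c \<in> C" "y = f c" by (elim imageE)
      then have "f c \<in> f ` frattini_ideal F n (A\<lparr>carrier := C\<rparr>)" using ess y by (intro imageI) simp
      then show "y \<in> {\<zero>\<^bsub>A'\<^esub>}" unfolding c(2) by (rule subsetD[OF triv[rule_format, OF CD(1)]])
    qed
    then show "frattini_ideal F n (A'\<lparr>carrier := D\<rparr>) = {\<zero>\<^bsub>A'\<^esub>}"
      using r.cod.frattini_ideal_trivial_iff by simp
  qed
qed

context skew_algebra
begin

text \<open>This identifies the elementary commutator as the least ideal that contains the Frattini ideals of
all subalgebras.\<close>

lemma elementary_quotient_iff:
  assumes "subalgebra_dcc F n A" and B: "nlie_ideal F n A B"
  shows "nlie_elementary F n (nlie_quot A B) \<longleftrightarrow>
    (\<forall>C. nlie_subalgebra F n A C \<longrightarrow> frattini_ideal F n (A\<lparr>carrier := C\<rparr>) \<subseteq> B)"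
proof -
  interpret q: skew_epimorphism F A n "nlie_quot A B" "\<lambda>x. B +> x"
    by (rule quotient_epimorphism[OF B])
  have "(\<lambda>x. B +> x) ` X \<subseteq> {\<zero>\<^bsub>nlie_quot A B\<^esub>} \<longleftrightarrow> X \<subseteq> B" if "X \<subseteq> carrier A" for X
    using that ideal_coset_eq_self_iff[OF B] by (auto simp: nlie_quot_def)
  then show ?thesis
    unfolding q.elementary_codomain_iff[OF assms(1)]
    using frattini_ideal_subalgebra_subset subalgebra_subset by (meson subset_trans)
qed

lemma elementary_commutator_ideal:
  assumes "subalgebra_dcc F n A"
  shows "nlie_ideal F n A (elementary_commutator F n A)"
  unfolding elementary_commutator_def
proof (rule ideal_Inter)
  have "nlie_elementary F n (nlie_quot A (carrier A))"
    unfolding elementary_quotient_iff[OF assms ideal_carrier]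
    using frattini_ideal_subalgebra_subset subalgebra_subset by (meson subset_trans)
  then show "{B. nlie_ideal F n A B \<and> nlie_elementary F n (nlie_quot A B)} \<noteq> {}"
    using ideal_carrier by blast
qed simp

lemma frattini_ideal_subset_elementary_commutator:
  assumes "subalgebra_dcc F n A" "nlie_subalgebra F n A C"
  shows "frattini_ideal F n (A\<lparr>carrier := C\<rparr>) \<subseteq> elementary_commutator F n A"
  using assms elementary_quotient_iff[OF assms(1)] unfolding elementary_commutator_def by blast

lemma elementary_commutator_least:
  assumes "subalgebra_dcc F n A" "nlie_ideal F n A B"
    and "\<And>C. nlie_subalgebra F n A C \<Longrightarrow> frattini_ideal F n (A\<lparr>carrier := C\<rparr>) \<subseteq> B"
  shows "elementary_commutator F n A \<subseteq> B"
  using assms elementary_quotient_iff[OF assms(1,2)] unfolding elementary_commutator_def by blast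

lemma elementary_commutator_quotient:
  assumes "subalgebra_dcc F n A"
  shows "nlie_elementary F n (nlie_quot A (elementary_commutator F n A))"
  using elementary_quotient_iff[OF assms elementary_commutator_ideal[OF assms]]
    frattini_ideal_subset_elementary_commutator[OF assms] by blast

text \<open>The elementary commutator of the whole algebra meets the subalgebra in an ideal of the latter that
contains the Frattini ideals of all smaller subalgebras.\<close>

lemma elementary_commutator_subalgebra:
  assumes dcc: "subalgebra_dcc F n A" and B: "nlie_subalgebra F n A B"
  shows "elementary_commutator F n (A\<lparr>carrier := B\<rparr>) \<subseteq> elementary_commutator F n A"
proof -
  interpret B: skew_algebra F "A\<lparr>carrier := B\<rparr>" n by (rule subalgebra_algebra[OF B])
  have "elementary_commutator F n (A\<lparr>carrier := B\<rparr>) \<subseteq> elementary_commutator F n A \<inter> B"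
  proof (rule B.elementary_commutator_least)
    show "subalgebra_dcc F n (A\<lparr>carrier := B\<rparr>)" using dcc B by (rule dcc_subalgebra)
    show "nlie_ideal F n (A\<lparr>carrier := B\<rparr>) (elementary_commutator F n A \<inter> B)"
      by (intro ideal_Int_subalgebra B elementary_commutator_ideal dcc)
    fix C assume "nlie_subalgebra F n (A\<lparr>carrier := B\<rparr>) C"
    then have C: "nlie_subalgebra F n A C" "C \<subseteq> B" by (auto simp: subalgebra_of_subalgebra_iff[OF B])
    then show "frattini_ideal F n (A\<lparr>carrier := B, carrier := C\<rparr>)
        \<subseteq> elementary_commutator F n A \<inter> B"
      using frattini_ideal_subset_elementary_commutator[OF dcc C(1)]
        frattini_ideal_subalgebra_subset[OF C(1)] by auto
  qed
  then show ?thesis by blast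
qed

text \<open>The quotient has no subalgebras besides zero and itself, so zero is a maximal subalgebra.\<close>

lemma maximal_ideal_quotient_elementary:
  assumes max: "maximal_subalgebra F n A M" and ideal: "nlie_ideal F n A M"
  shows "nlie_elementary F n (nlie_quot A M)"
proof -
  let ?Q = "nlie_quot A M"
  interpret q: skew_epimorphism F A n ?Q "\<lambda>x. M +> x"
    by (rule quotient_epimorphism[OF ideal])
  have zero: "M +> x = \<zero>\<^bsub>?Q\<^esub> \<longleftrightarrow> x \<in> M" if "x \<in> carrier A" for x
    using ideal_coset_eq_self_iff[OF ideal that] by (simp add: nlie_quot_def)
  have simple: "D = {\<zero>\<^bsub>?Q\<^esub>} \<or> D = carrier ?Q" if D: "nlie_subalgebra F n ?Q D" for D
  proof -
    let ?V = "carrier A \<inter> (\<lambda>x. M +> x) -` D"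
    have "\<zero>\<^bsub>?Q\<^esub> \<in> D" using D by (simp add: q.cod.nlie_subalgebra_iff)
    then have "M \<subseteq> ?V" using ideal_subset[OF ideal] zero by auto
    then have "?V = M \<or> ?V = carrier A"
      using max q.vimage_subalgebra[OF D] unfolding maximal_subalgebra_def by blast
    moreover have "(\<lambda>x. M +> x) ` ?V = D" by (intro q.image_vimage q.cod.subalgebra_subset[OF D])
    moreover have "(\<lambda>x. M +> x) ` M = {\<zero>\<^bsub>?Q\<^esub>}"
      using ideal_subset[OF ideal] zero ideal by (auto simp: nlie_ideal_iff)
    ultimately show ?thesis using q.image_carrier by auto
  qed
  have "{\<zero>\<^bsub>?Q\<^esub>} \<noteq> carrier ?Q"
  proof
    assume triv: "{\<zero>\<^bsub>?Q\<^esub>} = carrier ?Q"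
    have "carrier A \<subseteq> M"
    proof
      fix x assume x: "x \<in> carrier A"
      then show "x \<in> M" using q.hom_closed[OF x] zero[OF x] unfolding triv[symmetric] by simp
    qed
    then show False using max ideal_subset[OF ideal] by (auto simp: maximal_subalgebra_def)
  qed
  then have "maximal_subalgebra F n ?Q {\<zero>\<^bsub>?Q\<^esub>}"
    using simple q.cod.ideal_is_subalgebra[OF q.cod.ideal_zero]
    unfolding maximal_subalgebra_def by blast
  then have "frattini_ideal F n ?Q \<subseteq> {\<zero>\<^bsub>?Q\<^esub>}"
    using q.cod.frattini_ideal_subset unfolding frattini_subalgebra_def by blast
  then have whole: "frattini_ideal F n ?Q = {\<zero>\<^bsub>?Q\<^esub>}"
    by (simp add: q.cod.frattini_ideal_trivial_iff)
  show ?thesis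
    unfolding nlie_elementary_def
  proof (intro allI impI)
    fix D assume D: "nlie_subalgebra F n ?Q D"
    interpret D: skew_algebra F "?Q\<lparr>carrier := D\<rparr>" n by (rule q.cod.subalgebra_algebra[OF D])
    from simple[OF D] show "frattini_ideal F n (?Q\<lparr>carrier := D\<rparr>) = {\<zero>\<^bsub>?Q\<^esub>}"
    proof
      assume "D = {\<zero>\<^bsub>?Q\<^esub>}"
      then show ?thesis
        using q.cod.frattini_ideal_subalgebra_subset[OF D] D.frattini_ideal_trivial_iff by simp
    next
      assume "D = carrier ?Q"
      then show ?thesis using whole by simp
    qed
  qed
qed

end

context skew_epimorphism
begin

text \<open>The kernel is an ideal, so it contains the Frattini ideals of all subalgebras exactly if it contains
the least ideal that does.\<close>

lemma elementary_codomain_iff_commutator: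
  assumes dcc: "subalgebra_dcc F n A"
  shows "nlie_elementary F n A' \<longleftrightarrow> f ` elementary_commutator F n A \<subseteq> {\<zero>\<^bsub>A'\<^esub>}"
proof
  assume "nlie_elementary F n A'"
  then have triv: "f ` frattini_ideal F n (A\<lparr>carrier := C\<rparr>) \<subseteq> {\<zero>\<^bsub>A'\<^esub>}"
    if "nlie_subalgebra F n A C" for C
    using that elementary_codomain_iff[OF dcc] by blast
  have "elementary_commutator F n A \<subseteq> carrier A \<inter> f -` {\<zero>\<^bsub>A'\<^esub>}"
  proof (rule elementary_commutator_least[OF dcc])
    show "nlie_ideal F n A (carrier A \<inter> f -` {\<zero>\<^bsub>A'\<^esub>})"
      by (intro vimage_ideal cod.ideal_zero)
    fix C assume C: "nlie_subalgebra F n A C"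
    show "frattini_ideal F n (A\<lparr>carrier := C\<rparr>) \<subseteq> carrier A \<inter> f -` {\<zero>\<^bsub>A'\<^esub>}"
      using triv[OF C] frattini_ideal_subalgebra_subset[OF C] subalgebra_subset[OF C] by blast
  qed
  then show "f ` elementary_commutator F n A \<subseteq> {\<zero>\<^bsub>A'\<^esub>}" by blast
next
  assume "f ` elementary_commutator F n A \<subseteq> {\<zero>\<^bsub>A'\<^esub>}"
  then show "nlie_elementary F n A'"
    unfolding elementary_codomain_iff[OF dcc]
    using frattini_ideal_subset_elementary_commutator[OF dcc] by blast
qed

text \<open>An ideal \<open>B\<close> of the image has an elementary quotient exactly if the composite epimorphism onto
that quotient kills the elementary commutator, that is, if \<open>B\<close> contains its image. The image
is itself an ideal, hence the least such \<open>B\<close>.\<close>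

lemma elementary_commutator_image:
  assumes dcc: "subalgebra_dcc F n A"
  shows "elementary_commutator F n A' = f ` elementary_commutator F n A"
proof -
  let ?E = "elementary_commutator F n A"
  have E: "nlie_ideal F n A' (f ` ?E)"
    by (intro image_ideal elementary_commutator_ideal dcc)
  have "nlie_elementary F n (nlie_quot A' B) \<longleftrightarrow> f ` ?E \<subseteq> B" if B: "nlie_ideal F n A' B" for B
  proof -
    interpret c: skew_epimorphism F A n "nlie_quot A' B" "(\<lambda>y. B +>\<^bsub>A'\<^esub> y) \<circ> f"
      by (rule comp_epimorphism[OF skew_epimorphism_axioms cod.quotient_epimorphism[OF B]])
    have "B +>\<^bsub>A'\<^esub> y = \<zero>\<^bsub>nlie_quot A' B\<^esub> \<longleftrightarrow> y \<in> B" if "y \<in> f ` ?E" for y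
      using cod.ideal_coset_eq_self_iff[OF B, of y] cod.ideal_subset[OF E] that
      by (auto simp: nlie_quot_def)
    then show ?thesis
      unfolding c.elementary_codomain_iff_commutator[OF dcc] by auto
  qed
  then have "{B. nlie_ideal F n A' B \<and> nlie_elementary F n (nlie_quot A' B)}
      = {B. nlie_ideal F n A' B \<and> f ` ?E \<subseteq> B}" by blast
  then show ?thesis unfolding elementary_commutator_def[of F n A'] using E by auto
qed

end

section \<open>Direct sums of ideals\<close>

lemma (in abelian_group) finsum_hom:
  assumes "finite I" "x \<in> I \<rightarrow> carrier G" and h: "h \<in> carrier G \<rightarrow> carrier G" "h \<zero> = \<zero>"
    and add: "\<And>a b. a \<in> carrier G \<Longrightarrow> b \<in> carrier G \<Longrightarrow> h (a \<oplus> b) = h a \<oplus> h b"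
  shows "h (\<Oplus>i\<in>I. x i) = (\<Oplus>i\<in>I. h (x i))"
  using assms(1,2)
proof (induction I rule: finite_induct)
  case (insert j J)
  then have "x j \<in> carrier G" "x \<in> J \<rightarrow> carrier G" by auto
  then show ?case using insert h funcset_mem[OF h(1)] by (simp add: finsum_insert Pi_iff add finsum_closed)
qed (simp add: h)

lemma (in vectorspace) finsum_in_subspace:
  assumes "finite I" "subspace K B V" "\<And>i. i \<in> I \<Longrightarrow> x i \<in> B"
  shows "(\<Oplus>\<^bsub>V\<^esub>i\<in>I. x i) \<in> B"
  using assms(1,3)
proof (induction I rule: finite_induct)
  case empty
  then show ?case using assms(2) by (simp add: subspace_iff)
next
  case (insert j J)
  have B: "B \<subseteq> carrier V" using assms(2) by (simp add: subspace_iff)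
  have "x j \<in> carrier V" "x \<in> J \<rightarrow> carrier V" using insert.prems B by auto
  moreover have "x j \<oplus>\<^bsub>V\<^esub> (\<Oplus>\<^bsub>V\<^esub>i\<in>J. x i) \<in> B"
    using insert assms(2) by (simp add: subspace_iff)
  ultimately show ?case using insert.hyps by (simp add: M.finsum_insert)
qed

locale ideal_direct_sum = skew_algebra F A n
  for F :: "('a, 'm) ring_scheme" and A :: "('a, 'b, 'c) n_lie_scheme" (structure) and n :: nat +
  fixes I :: "'i set" and B :: "'i \<Rightarrow> 'b set"
  assumes finite_index: "finite I"
    and summand_ideal: "i \<in> I \<Longrightarrow> nlie_ideal F n A (B i)"
    and direct_sum: "internal_direct_sum A I B (carrier A)"
begin

definition component :: "'i \<Rightarrow> 'b \<Rightarrow> 'b" where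
  "component i x = inv_into (\<Pi>\<^sub>E i\<in>I. B i) (\<lambda>x. \<Oplus>i\<in>I. x i) x i"

lemma summand_subset: "i \<in> I \<Longrightarrow> B i \<subseteq> carrier A"
  using summand_ideal ideal_subset by blast

lemma summand_subspace: "i \<in> I \<Longrightarrow> subspace F (B i) A"
  using summand_ideal by (simp add: nlie_ideal_def)

lemma component_in_summand:
  assumes "x \<in> carrier A" "i \<in> I"
  shows "component i x \<in> B i"
proof -
  have "x \<in> (\<lambda>x. \<Oplus>i\<in>I. x i) ` (\<Pi>\<^sub>E i\<in>I. B i)"
    using direct_sum assms by (simp add: internal_direct_sum_def bij_betw_def)
  from PiE_mem[OF inv_into_into[OF this] assms(2)] show ?thesis unfolding component_def .
qed

lemma component_closed: "x \<in> carrier A \<Longrightarrow> i \<in> I \<Longrightarrow> component i x \<in> carrier A"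
  using component_in_summand summand_subset by blast

lemma finsum_component:
  assumes "x \<in> carrier A"
  shows "(\<Oplus>i\<in>I. component i x) = x"
proof -
  have "x \<in> (\<lambda>x. \<Oplus>i\<in>I. x i) ` (\<Pi>\<^sub>E i\<in>I. B i)"
    using direct_sum assms by (simp add: internal_direct_sum_def bij_betw_def)
  from f_inv_into_f[OF this] show ?thesis unfolding component_def .
qed

lemma component_finsum:
  assumes y: "\<And>i. i \<in> I \<Longrightarrow> y i \<in> B i" and i: "i \<in> I"
  shows "component i (\<Oplus>i\<in>I. y i) = y i"
proof -
  have mem: "restrict y I \<in> (\<Pi>\<^sub>E i\<in>I. B i)" using y by auto
  have inj: "inj_on (\<lambda>x. \<Oplus>i\<in>I. x i) (\<Pi>\<^sub>E i\<in>I. B i)"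
    using direct_sum by (simp add: internal_direct_sum_def bij_betw_def)
  have "component i (\<Oplus>i\<in>I. restrict y I i) = restrict y I i"
    unfolding component_def by (rule fun_cong[OF inv_into_f_f[OF inj mem]])
  moreover have "(\<Oplus>i\<in>I. restrict y I i) = (\<Oplus>i\<in>I. y i)"
    using y summand_subset by (intro M.finsum_cong') auto
  ultimately show ?thesis using i by simp
qed

lemma component_add:
  assumes "x \<in> carrier A" "y \<in> carrier A" "i \<in> I"
  shows "component i (x \<oplus> y) = component i x \<oplus> component i y"
proof -
  have "x \<oplus> y = (\<Oplus>i\<in>I. component i x) \<oplus> (\<Oplus>i\<in>I. component i y)"
    using assms by (simp add: finsum_component)
  also have "\<dots> = (\<Oplus>i\<in>I. component i x \<oplus> component i y)"
    using assms component_closed by (intro M.finsum_addf[symmetric]) auto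
  finally have "x \<oplus> y = (\<Oplus>i\<in>I. component i x \<oplus> component i y)" .
  moreover have "component i x \<oplus> component i y \<in> B i" if "i \<in> I" for i
    using summand_subspace[OF that] component_in_summand assms that by (simp add: subspace_iff)
  ultimately show ?thesis using component_finsum assms(3) by simp
qed

lemma component_smult:
  assumes "c \<in> carrier F" "x \<in> carrier A" "i \<in> I"
  shows "component i (c \<odot> x) = c \<odot> component i x"
proof -
  have "c \<odot> x = c \<odot> (\<Oplus>i\<in>I. component i x)"
    using assms by (simp add: finsum_component)
  also have "\<dots> = (\<Oplus>i\<in>I. c \<odot> component i x)"
    using assms component_closed finite_index
    by (intro M.finsum_hom) (auto simp: smult_r_distr)
  finally have "c \<odot> x = (\<Oplus>i\<in>I. c \<odot> component i x)" .
  moreover have "c \<odot> component i x \<in> B i" if "i \<in> I" for i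
    using summand_subspace[OF that] component_in_summand assms that by (simp add: subspace_iff)
  ultimately show ?thesis using component_finsum assms(3) by simp
qed

lemma component_zero:
  assumes "i \<in> I"
  shows "component i \<zero> = \<zero>"
proof -
  have "(\<Oplus>i\<in>I. \<zero>) = \<zero>" by (rule M.finsum_zero)
  then show ?thesis
    using component_finsum[of "\<lambda>_. \<zero>" i] summand_subspace assms by (simp add: subspace_iff)
qed

lemma component_of_summand:
  assumes "i \<in> I" "x \<in> B i"
  shows "component i x = x"
proof -
  have x: "x \<in> carrier A" using assms summand_subset by blast
  have "(\<Oplus>j\<in>I. if i = j then x else \<zero>) = x"
    using assms x finite_index by (intro M.finsum_singleton) auto
  moreover have "(if i = j then x else \<zero>) \<in> B j" if "j \<in> I" for j
    using summand_subspace[OF that] assms by (auto simp: subspace_iff)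
  ultimately show ?thesis
    using component_finsum[of "\<lambda>j. if i = j then x else \<zero>" i] assms by simp
qed

text \<open>Expand the first argument into its components: the summand with index \<open>i\<close> stays in the ideal
\<open>B i\<close>, whatever the other arguments are.\<close>

lemma component_bracket_Cons:
  assumes x: "x \<in> carrier A" and ys: "length ys = n - 1" "set ys \<subseteq> carrier A" and i: "i \<in> I"
  shows "component i (bracket A (x # ys)) = bracket A (component i x # ys)"
proof -
  let ?h = "\<lambda>x. bracket A (x # ys)"
  have len: "length (z # ys) = n" for z using ys arity_pos by simp
  have "?h (\<Oplus>i\<in>I. component i x) = (\<Oplus>i\<in>I. ?h (component i x))"
  proof (rule M.finsum_hom)
    show "?h \<in> carrier A \<rightarrow> carrier A" using len ys by (auto intro!: bracket_closed)
    show "?h \<zero> = \<zero>" using bracket_zero[of "\<zero> # ys" 0] len ys arity_pos by simp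
    show "?h (a \<oplus> b) = ?h a \<oplus> ?h b" if "a \<in> carrier A" "b \<in> carrier A" for a b
      using bracket_add[of "a # ys" 0 a b] that len ys arity_pos by simp
  qed (use finite_index component_closed x in auto)
  then have "?h x = (\<Oplus>i\<in>I. ?h (component i x))" using x by (simp add: finsum_component)
  moreover have "?h (component i x) \<in> B i" if "i \<in> I" for i
    using summand_ideal[OF that] component_in_summand[OF x that] ys by (simp add: nlie_ideal_def)
  ultimately show ?thesis using component_finsum i by simp
qed

text \<open>The kernel of a component map is an ideal by the previous lemma, and every element is congruent to
its component modulo that kernel. So a bracket is congruent to the bracket of the components, which
lies in the summand, where the component map is the identity.\<close>

lemma component_bracket:
  assumes xs: "length xs = n" "set xs \<subseteq> carrier A" and i: "i \<in> I"
  shows "component i (bracket A xs) = bracket A (map (component i) xs)"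
proof -
  define K where "K = {x \<in> carrier A. component i x = \<zero>}"
  have K: "nlie_ideal F n A K"
    unfolding nlie_ideal_iff
  proof (intro conjI ballI allI impI)
    fix x ys assume x: "x \<in> K \<and> length ys = n - 1 \<and> set ys \<subseteq> carrier A"
    then have "bracket A (\<zero> # ys) = \<zero>" using bracket_zero[of "\<zero> # ys" 0] arity_pos by simp
    then show "bracket A (x # ys) \<in> K"
      using x i arity_pos by (auto simp: K_def component_bracket_Cons bracket_closed)
  qed (use i in \<open>auto simp: K_def component_zero component_add component_smult\<close>)
  have same: "component i x = component i y" if "x \<ominus> y \<in> K" "x \<in> carrier A" "y \<in> carrier A" for x y
  proof -
    have "x = (x \<ominus> y) \<oplus> y" using that by (simp add: M.minus_eq M.a_assoc M.l_neg)
    then have "component i x = component i (x \<ominus> y) \<oplus> component i y"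
      using component_add[of "x \<ominus> y" y i] that i by (simp add: K_def)
    then show ?thesis using that i by (simp add: K_def component_closed)
  qed
  let ?ys = "map (component i) xs"
  have ys: "length ?ys = n" "set ?ys \<subseteq> B i" using xs i component_in_summand by auto
  then have ysA: "set ?ys \<subseteq> carrier A" using summand_subset[OF i] by blast
  have "xs ! k \<ominus> ?ys ! k \<in> K" if "k < n" for k
  proof -
    define x where "x = xs ! k"
    have x: "x \<in> carrier A" using xs that nth_mem[of k xs] by (auto simp: x_def)
    have cx: "component i x \<in> carrier A" "component i (component i x) = component i x"
      using component_closed[OF x i] component_of_summand[OF i component_in_summand[OF x i]] .
    have neg: "\<ominus> component i x \<in> B i"
      using subspace_minus[OF summand_subspace[OF i] component_in_summand[OF x i]] .
    have "component i (x \<ominus> component i x) = \<zero>"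
      using component_add[OF x M.a_inv_closed[OF cx(1)] i] component_of_summand[OF i neg] cx
      by (simp add: M.minus_eq M.r_neg)
    then have "x \<ominus> component i x \<in> K" using x cx by (simp add: K_def)
    then show ?thesis using xs that by (simp add: x_def)
  qed
  then have "bracket A xs \<ominus> bracket A ?ys \<in> K"
    by (intro bracket_cong_mod_ideal[OF K xs ys(1) ysA])
  then have "component i (bracket A xs) = component i (bracket A ?ys)"
    using xs ys(1) ysA by (intro same bracket_closed)
  also have "\<dots> = bracket A ?ys"
    using ideal_is_subalgebra[OF summand_ideal[OF i]] ys
    by (intro component_of_summand[OF i]) (simp add: nlie_subalgebra_def)
  finally show ?thesis .
qed

lemma component_epimorphism:
  assumes i: "i \<in> I"
  shows "skew_epimorphism F A n (A\<lparr>carrier := B i\<rparr>) (component i)"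
proof (intro skew_epimorphism.intro skew_epimorphism_axioms.intro)
  show "skew_algebra F A n" by unfold_locales
  show "component i ` carrier A = carrier (A\<lparr>carrier := B i\<rparr>)"
  proof (intro equalityI subsetI)
    fix x assume "x \<in> carrier (A\<lparr>carrier := B i\<rparr>)"
    then have "x \<in> carrier A" "x = component i x"
      using summand_subset[OF i] component_of_summand[OF i] by auto
    then show "x \<in> component i ` carrier A" by (rule rev_image_eqI)
  qed (use component_in_summand i in auto)
qed (use i in \<open>simp_all add: component_zero component_add component_smult component_bracket\<close>)

text \<open>Each component map is an epimorphism onto its summand, so the elementary commutators of the summands
are the components of the elementary commutator of the sum; they also lie in it, because \<open>E\<close> is monotone in
the subalgebra.\<close>

lemma elementary_commutator_direct_sum:
  assumes dcc: "subalgebra_dcc F n A"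
  shows "internal_direct_sum A I (\<lambda>i. elementary_commutator F n (A\<lparr>carrier := B i\<rparr>))
    (elementary_commutator F n A)"
proof -
  let ?E = "elementary_commutator F n A" and ?Ei = "\<lambda>i. elementary_commutator F n (A\<lparr>carrier := B i\<rparr>)"
  have E: "nlie_ideal F n A ?E" by (rule elementary_commutator_ideal[OF dcc])
  have image: "?Ei i = component i ` ?E" if "i \<in> I" for i
    by (rule skew_epimorphism.elementary_commutator_image[OF component_epimorphism[OF that] dcc])
  have sub: "?Ei i \<subseteq> ?E" if "i \<in> I" for i
    using ideal_is_subalgebra[OF summand_ideal[OF that]]
    by (rule elementary_commutator_subalgebra[OF dcc])
  have subB: "?Ei i \<subseteq> B i" if "i \<in> I" for i
    using image[OF that] component_in_summand[OF _ that] ideal_subset[OF E] by auto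
  show ?thesis
    unfolding internal_direct_sum_def bij_betw_def
  proof (intro conjI equalityI subsetI)
    have "(\<Pi>\<^sub>E i\<in>I. ?Ei i) \<subseteq> (\<Pi>\<^sub>E i\<in>I. B i)" by (intro PiE_mono subB)
    then show "inj_on (\<lambda>x. \<Oplus>i\<in>I. x i) (\<Pi>\<^sub>E i\<in>I. ?Ei i)"
      using direct_sum by (auto simp: internal_direct_sum_def bij_betw_def intro: inj_on_subset)
  next
    fix e assume "e \<in> (\<lambda>x. \<Oplus>i\<in>I. x i) ` (\<Pi>\<^sub>E i\<in>I. ?Ei i)"
    then obtain x where x: "x \<in> (\<Pi>\<^sub>E i\<in>I. ?Ei i)" "e = (\<Oplus>i\<in>I. x i)" by blast
    have "x i \<in> ?E" if "i \<in> I" for i using x(1) sub[OF that] that by (auto dest: PiE_mem)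
    then show "e \<in> ?E"
      unfolding x(2) using E finite_index by (intro finsum_in_subspace) (auto simp: nlie_ideal_def)
  next
    fix e assume e: "e \<in> ?E"
    then have eA: "e \<in> carrier A" using ideal_subset[OF E] by blast
    let ?x = "\<lambda>i\<in>I. component i e"
    have "(\<Oplus>i\<in>I. ?x i) = (\<Oplus>i\<in>I. component i e)"
      using component_closed[OF eA] by (intro M.finsum_cong') auto
    then have "e = (\<Oplus>i\<in>I. ?x i)" by (simp add: finsum_component[OF eA])
    moreover have "?x \<in> (\<Pi>\<^sub>E i\<in>I. ?Ei i)" using image e by auto
    ultimately show "e \<in> (\<lambda>x. \<Oplus>i\<in>I. x i) ` (\<Pi>\<^sub>E i\<in>I. ?Ei i)" by (rule image_eqI)
  qed
qed

end

section \<open>The elementary commutator of an n-Lie algebra\<close>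

theorem theorem3p8:
  fixes F :: "('a, 'm) ring_scheme" and A :: "('a, 'b, 'c) n_lie_scheme" and n :: nat
  assumes "n_lie_algebra F A n"
    and "vectorspace.fin_dim F A"
  shows
    "((\<exists>!E. nlie_ideal F n A E \<and> nlie_elementary F n (nlie_quot A E) \<and>
        (\<forall>B. nlie_ideal F n A B \<and> nlie_elementary F n (nlie_quot A B) \<longrightarrow> E \<subseteq> B)) \<and>
      nlie_ideal F n A (elementary_commutator F n A) \<and>
      nlie_elementary F n (nlie_quot A (elementary_commutator F n A)) \<and>
      (\<forall>B. nlie_ideal F n A B \<and> nlie_elementary F n (nlie_quot A B) \<longrightarrow>
        elementary_commutator F n A \<subseteq> B)) \<and>
    (frattini_ideal F n A \<subseteq> elementary_commutator F n A \<and>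
      elementary_commutator F n A \<subseteq> maximal_ideal_intersection F n A) \<and>
    (\<forall>B. nlie_subalgebra F n A B \<longrightarrow>
      frattini_ideal F n (A\<lparr>carrier := B\<rparr>) \<subseteq> elementary_commutator F n A) \<and>
    (E_algebra F n A \<longleftrightarrow> elementary_commutator F n A = frattini_ideal F n A) \<and>
    (\<forall>(m::nat) Ai. (\<forall>i\<in>{1..m}. nlie_ideal F n A (Ai i)) \<and>
        internal_direct_sum A {1..m} Ai (carrier A) \<longrightarrow>
      internal_direct_sum A {1..m} (\<lambda>i. elementary_commutator F n (A\<lparr>carrier := Ai i\<rparr>))
        (elementary_commutator F n A)) \<and>
    (\<not> nlie_elementary F n A \<and>
        (\<forall>B. nlie_ideal F n A B \<and> B \<noteq> {\<zero>\<^bsub>A\<^esub>} \<longrightarrow> nlie_elementary F n (nlie_quot A B)) \<longrightarrow>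
      (\<exists>!I. minimal_ideal F n A I)) \<and>
    (\<forall>K. nlie_ideal F n A K \<longrightarrow>
      elementary_commutator F n (nlie_quot A K) =
        carrier (nlie_quot (A\<lparr>carrier := elementary_commutator F n A <+>\<^bsub>A\<^esub> K\<rparr>) K))"
proof -
  interpret skew_algebra F A n by (rule n_lie_algebra.skew_algebra[OF assms(1)])
  have dcc: "subalgebra_dcc F n A"
    by (rule fin_dim_subalgebra_dcc[OF vectorspace_axioms assms(2)])
  let ?E = "elementary_commutator F n A"
  have E: "nlie_ideal F n A ?E" "nlie_elementary F n (nlie_quot A ?E)"
    by (rule elementary_commutator_ideal[OF dcc], rule elementary_commutator_quotient[OF dcc])
  have least: "?E \<subseteq> B" if "nlie_ideal F n A B" "nlie_elementary F n (nlie_quot A B)" for B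
    using that unfolding elementary_commutator_def by blast
  have sub: "frattini_ideal F n (A\<lparr>carrier := B\<rparr>) \<subseteq> ?E" if "nlie_subalgebra F n A B" for B
    by (rule frattini_ideal_subset_elementary_commutator[OF dcc that])
  have self: "frattini_ideal F n A \<subseteq> ?E" using sub[OF subalgebra_carrier] by simp
  have unique: "\<exists>!E. nlie_ideal F n A E \<and> nlie_elementary F n (nlie_quot A E) \<and>
      (\<forall>B. nlie_ideal F n A B \<and> nlie_elementary F n (nlie_quot A B) \<longrightarrow> E \<subseteq> B)"
    using E least by (intro ex1I[of _ ?E]) (auto intro!: equalityI)
  have maximal: "?E \<subseteq> maximal_ideal_intersection F n A"
    using least maximal_ideal_quotient_elementary ideal_subset[OF E(1)]
    unfolding maximal_ideal_intersection_def by blast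
  have E_algebra: "E_algebra F n A \<longleftrightarrow> ?E = frattini_ideal F n A"
  proof
    assume "E_algebra F n A"
    then have "?E \<subseteq> frattini_ideal F n A"
      by (intro elementary_commutator_least[OF dcc frattini_ideal_ideal]) (simp add: E_algebra_def)
    then show "?E = frattini_ideal F n A" using self by blast
  next
    assume "?E = frattini_ideal F n A"
    then show "E_algebra F n A" using sub by (simp add: E_algebra_def)
  qed
  have direct_sum: "internal_direct_sum A {1..m} (\<lambda>i. elementary_commutator F n (A\<lparr>carrier := Ai i\<rparr>)) ?E"
    if "\<forall>i\<in>{1..m}. nlie_ideal F n A (Ai i)" "internal_direct_sum A {1..m} Ai (carrier A)"
    for m :: nat and Ai
  proof -
    interpret ideal_direct_sum F A n "{1..m}" Ai using that by unfold_locales auto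
    show ?thesis by (rule elementary_commutator_direct_sum[OF dcc])
  qed
  have minimal: "\<exists>!I. minimal_ideal F n A I"
    if "\<not> nlie_elementary F n A"
      and quot: "\<forall>B. nlie_ideal F n A B \<and> B \<noteq> {\<zero>\<^bsub>A\<^esub>} \<longrightarrow> nlie_elementary F n (nlie_quot A B)"
  proof (rule ex1I)
    have in_all: "?E \<subseteq> B" if "nlie_ideal F n A B" "B \<noteq> {\<zero>\<^bsub>A\<^esub>}" for B
      using that quot least by blast
    have "?E \<noteq> {\<zero>\<^bsub>A\<^esub>}"
      using that(1) skew_epimorphism.elementary_codomain_iff_commutator[OF id_epimorphism dcc] by auto
    then show "minimal_ideal F n A ?E"
      using E(1) in_all unfolding minimal_ideal_def by blast
    then show "I = ?E" if "minimal_ideal F n A I" for I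
      using that in_all unfolding minimal_ideal_def by blast
  qed
  have quotient: "elementary_commutator F n (nlie_quot A K) =
      carrier (nlie_quot (A\<lparr>carrier := ?E <+>\<^bsub>A\<^esub> K\<rparr>) K)" if K: "nlie_ideal F n A K" for K
  proof -
    interpret q: skew_epimorphism F A n "nlie_quot A K" "\<lambda>x. K +>\<^bsub>A\<^esub> x"
      by (rule quotient_epimorphism[OF K])
    have coset: "K +>\<^bsub>A\<^esub> (e \<oplus>\<^bsub>A\<^esub> k) = K +>\<^bsub>A\<^esub> e" if "e \<in> ?E" "k \<in> K" for e k
    proof -
      have "e \<in> carrier A" "k \<in> carrier A" using that ideal_subset[OF E(1)] ideal_subset[OF K] by auto
      moreover from this have "(e \<oplus>\<^bsub>A\<^esub> k) \<ominus>\<^bsub>A\<^esub> e = k"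
        by (simp add: M.minus_eq M.a_comm[of e k] M.a_assoc M.r_neg)
      ultimately show ?thesis using that by (simp add: ideal_coset_eq_iff[OF K])
    qed
    have zero: "\<zero>\<^bsub>A\<^esub> \<in> K" "e \<oplus>\<^bsub>A\<^esub> \<zero>\<^bsub>A\<^esub> = e" if "e \<in> ?E" for e
      using K ideal_subset[OF E(1)] that by (auto simp: nlie_ideal_iff)
    have "carrier (nlie_quot (A\<lparr>carrier := ?E <+>\<^bsub>A\<^esub> K\<rparr>) K) = (\<lambda>x. K +>\<^bsub>A\<^esub> x) ` (?E <+>\<^bsub>A\<^esub> K)"
      by (auto simp: nlie_quot_def A_RCOSETS_def' a_r_coset_def')
    also have "\<dots> = (\<lambda>x. K +>\<^bsub>A\<^esub> x) ` ?E"
    proof (intro equalityI image_subsetI)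
      fix x assume "x \<in> ?E <+>\<^bsub>A\<^esub> K"
      then obtain e k where "e \<in> ?E" "k \<in> K" "x = e \<oplus>\<^bsub>A\<^esub> k" by (auto simp: set_add_def')
      then show "K +>\<^bsub>A\<^esub> x \<in> (\<lambda>x. K +>\<^bsub>A\<^esub> x) ` ?E" using coset by auto
    next
      fix e assume e: "e \<in> ?E"
      then have "e \<oplus>\<^bsub>A\<^esub> \<zero>\<^bsub>A\<^esub> \<in> ?E <+>\<^bsub>A\<^esub> K" using zero unfolding set_add_def' by blast
      then show "K +>\<^bsub>A\<^esub> e \<in> (\<lambda>x. K +>\<^bsub>A\<^esub> x) ` (?E <+>\<^bsub>A\<^esub> K)" using zero[OF e] by simp
    qed
    finally show ?thesis using q.elementary_commutator_image[OF dcc] by simp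
  qed
  show ?thesis
  proof (intro conjI allI impI, goal_cases)
    case 1 show ?case by (rule unique)
  next
    case 2 show ?case by (rule E)
  next
    case 3 show ?case by (rule E)
  next
    case (4 B) then show ?case by (intro least) simp_all
  next
    case 5 show ?case by (rule self)
  next
    case 6 show ?case by (rule maximal)
  next
    case (7 B) then show ?case by (rule sub)
  next
    case 8 show ?case by (rule E_algebra)
  next
    case (9 m Ai) then show ?case by (intro direct_sum) simp_all
  next
    case 10 then show ?case by (intro minimal) simp_all
  next
    case (11 K) then show ?case by (rule quotient)
  qed
qed

end
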